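(* For each of the following two pairs of polynomials $(f,g)$ of degree $4$, the hypergeometric group $H(f,g)$ is arithmetic: (1) $f(t)=(t-1)^2(t^2+t+1)$ and $g(t)=(t+1)^2(t^2+1)$; (2) $f(t)=(t-1)^2(t^2+1)$ and $g(t)=(t+1)^2(t^2-t+1)$.
   Context: For monic polynomials $f(t)=t^n+A_1t^{n-1}+\cdots+A_n$ and $g(t)=t^n+B_1t^{n-1}+\cdots+B_n$ in $\mathbb{Z}[t]$ with no common root in $\mathbb{C}$ and with $A_n,B_n\in\{1,-1\}$, let $A$ and $B$ be the companion matrices $$A=\begin{pmatrix}0&\cdots&0&-A_n\\1&\cdots&0&-A_{n-1}\\\vdots&\ddots&\vdots&\vdots\\0&\cdots&1&-A_1\end{pmatrix},\qquad B=\begin{pmatrix}0&\cdots&0&-B_n\\1&\cdots&0&-B_{n-1}\\\vdots&\ddots&\vdots&\vdots\\0&\cdots&1&-B_1\end{pmatrix},$$ and let $H(f,g)=\langle A,B^{-1}\rangle\leq \mathrm{GL}(n,\mathbb{Z})$. This is the hypergeometric group $H(a,b)$, where $a$ and $b$ are the lists of roots of $f$ and $g$ respectively. For the pairs considered here, $H(f,g)$ preserves a non-degenerate skew-symmetric bilinear form with rational matrix $\Phi$, unique up to a scalar multiple, so that $H(f,g)\leq \mathrm{Sp}(\Phi,\mathbb{Z})=\{h\in \mathrm{GL}(n,\mathbb{Z}) : h\Phi h^\top=\Phi\}$. The group $H(f,g)$ is called arithmetic if it has finite index in $\mathrm{Sp}(\Phi,\mathbb{Z})$. *)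

theory Defs
  imports
    "HOL-Computational_Algebra.Polynomial"
    "HOL-Algebra.Coset"
    "HOL-Algebra.Generated_Groups"
    "Jordan_Normal_Form.Determinant"
begin

definition GL_int :: "nat \<Rightarrow> int mat monoid" where
  "GL_int n = units_of (ring_mat TYPE(int) n ())"

(* For monic f = t^n + A_1 t^(n-1) + ... + A_n we have A_(n-i) = coeff f i, so with rows
   and columns numbered from 0, the entry -A_(n-i) stands in row i of the last column. *)
definition companion :: "int poly \<Rightarrow> int mat" where
  "companion f = mat (degree f) (degree f)
     (\<lambda>(i, j). if j = degree f - 1 then - coeff f i else if i = j + 1 then 1 else 0)"

(* Meaningful for monic f and g of the same degree whose constant coefficients are 1 or -1,
   so that both companion matrices lie in GL(n, Z). *)
definition hypergeometric_group :: "int poly \<Rightarrow> int poly \<Rightarrow> int mat set" where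
  "hypergeometric_group f g =
     generate (GL_int (degree f))
       {companion f, inv\<^bsub>GL_int (degree f)\<^esub> (companion g)}"

definition preserves_form :: "rat mat \<Rightarrow> int mat \<Rightarrow> bool" where
  "preserves_form \<Phi> h \<longleftrightarrow>
     map_mat rat_of_int h * \<Phi> * transpose_mat (map_mat rat_of_int h) = \<Phi>"

definition nondegenerate_skew_form :: "nat \<Rightarrow> rat mat \<Rightarrow> bool" where
  "nondegenerate_skew_form n \<Phi> \<longleftrightarrow>
     \<Phi> \<in> carrier_mat n n \<and> transpose_mat \<Phi> = - \<Phi> \<and> det \<Phi> \<noteq> 0"

definition Sp_int :: "nat \<Rightarrow> rat mat \<Rightarrow> int mat monoid" where
  "Sp_int n \<Phi> = (GL_int n)\<lparr>carrier := {h \<in> carrier (GL_int n). preserves_form \<Phi> h}\<rparr>"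

definition finite_index_subgroup :: "'a set \<Rightarrow> ('a, 'b) monoid_scheme \<Rightarrow> bool" where
  "finite_index_subgroup H G \<longleftrightarrow> subgroup H G \<and> finite (rcosets\<^bsub>G\<^esub> H)"

(* The invariant form is determined only up to a scalar (which does not affect Sp_int).
   Instead of choosing one, we ask that such a form exists and that H has finite index
   in Sp_int for every such form. *)
definition arithmetic_group :: "nat \<Rightarrow> int mat set \<Rightarrow> bool" where
  "arithmetic_group n H \<longleftrightarrow>
     (\<exists>\<Phi>. nondegenerate_skew_form n \<Phi> \<and> (\<forall>h\<in>H. preserves_form \<Phi> h)) \<and>
     (\<forall>\<Phi>. nondegenerate_skew_form n \<Phi> \<and> (\<forall>h\<in>H. preserves_form \<Phi> h) \<longrightarrow>
        finite_index_subgroup H (Sp_int n \<Phi>))"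

end

(* For f and g of (1), the group H generated by the companion matrices acts on row vectors and
   preserves a symplectic form of type (1, 8); e1, f1, e2, f2 denotes a basis with <e1, f1> = 1 and
   <e2, f2> = 8. The matrix A^-1 B is a transvection T_x : v -> v + <v, x> x (up to inversion), so H
   contains T_x for every x in the orbit of its centre. This orbit contains e1, f1, e1 + e2 and e1 + f2.

   From these four transvections one gets SL(2,Z) on <e1, f1>, all T_{e1 + y} with y in <e2, f2>, and
   the double Eichler transformations. The subgroup they generate is normalised by SL(2,Z) acting on
   <e2, f2>, and a Euclidean reduction of the image of e1 shows that the two together exhaust the full
   isometry group. Finally, a Mennicke-type computation shows that H contains every element of the
   second SL(2,Z) that is congruent to 1 modulo 32, which leaves finitely many cosets.

   The pair (2) is obtained from the pair (1) by t -> -t and exchanging f and g, so up to conjugation by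
   diag(1, -1, 1, -1) its group is generated by -A and -B, to which the same argument applies. *)
theory Submission
  imports Defs
begin

section \<open>Isometries of the lattice of type (1, 8)\<close>

type_synonym vec4 = "int \<times> int \<times> int \<times> int"

(* The notation inv of Hilbert_Choice is shadowed by the group inverse of HOL-Algebra. *)
abbreviation finv :: "('a \<Rightarrow> 'b) \<Rightarrow> 'b \<Rightarrow> 'a" where
  "finv f \<equiv> inv_into UNIV f"

(* Coordinates refer to a basis e1, f1, e2, f2 with <e1, f1> = 1 and <e2, f2> = 8. *)
fun form :: "vec4 \<Rightarrow> vec4 \<Rightarrow> int" where
  "form (a, b, c, d) (a', b', c', d') = a * b' - b * a' + 8 * (c * d' - d * c')"

fun vadd :: "vec4 \<Rightarrow> int \<Rightarrow> vec4 \<Rightarrow> vec4" where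
  "vadd (a, b, c, d) k (a', b', c', d') = (a + k * a', b + k * b', c + k * c', d + k * d')"

text \<open>Since \<open>vadd x k y\<close> is x + k y, the second clause is Z-linearity in a single
  equation. Bijectivity is a separate hypothesis where it is used.\<close>

definition isometry :: "(vec4 \<Rightarrow> vec4) \<Rightarrow> bool" where
  "isometry g \<longleftrightarrow> (\<forall>x y. form (g x) (g y) = form x y) \<and>
     (\<forall>x k y. g (vadd x k y) = vadd (g x) k (g y))"

section \<open>Transvections, two copies of SL(2,Z), and Eichler transformations\<close>

definition transv :: "vec4 \<Rightarrow> vec4 \<Rightarrow> vec4" where
  "transv x v = vadd v (form v x) x"

fun sl1 :: "int \<Rightarrow> int \<Rightarrow> int \<Rightarrow> int \<Rightarrow> vec4 \<Rightarrow> vec4" where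
  "sl1 p q r s (a, b, c, d) = (a * p + b * r, a * q + b * s, c, d)"

fun sl2 :: "int \<Rightarrow> int \<Rightarrow> int \<Rightarrow> int \<Rightarrow> vec4 \<Rightarrow> vec4" where
  "sl2 p q r s (a, b, c, d) = (a, b, c * p + d * r, c * q + d * s)"

(* v -> v + <v, e1> y + <v, y> e1 for y = m e2 + n f2. *)
fun eichler :: "int \<Rightarrow> int \<Rightarrow> vec4 \<Rightarrow> vec4" where
  "eichler m n (a, b, c, d) = (a + 8 * (c * n - d * m), b, c - b * m, d - b * n)"

lemma isometry_transv: "isometry (transv x)"
  unfolding isometry_def transv_def
  by (cases x) (auto simp: algebra_simps)

lemma det_form_eq:
  fixes a b p q r s :: int
  assumes "p * s - q * r = 1"
  shows "(a * p + b * r) * (a' * q + b' * s) - (a * q + b * s) * (a' * p + b' * r) = a * b' - b * a'"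
proof -
  have "(a * p + b * r) * (a' * q + b' * s) - (a * q + b * s) * (a' * p + b' * r)
    = (a * b' - b * a') * (p * s - q * r)" by (simp add: algebra_simps)
  then show ?thesis using assms by simp
qed

lemma isometry_sl1:
  assumes "p * s - q * r = 1"
  shows "isometry (sl1 p q r s)"
proof -
  have "form (sl1 p q r s x) (sl1 p q r s y) = form x y" for x y
    by (cases x, cases y) (simp add: det_form_eq[OF assms])
  moreover have "sl1 p q r s (vadd x k y) = vadd (sl1 p q r s x) k (sl1 p q r s y)" for x k y
    by (cases x, cases y) (simp add: algebra_simps)
  ultimately show ?thesis unfolding isometry_def by blast
qed

lemma isometry_sl2:
  assumes "p * s - q * r = 1"
  shows "isometry (sl2 p q r s)"
proof -
  have "form (sl2 p q r s x) (sl2 p q r s y) = form x y" for x y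
    by (cases x, cases y) (simp add: det_form_eq[OF assms])
  moreover have "sl2 p q r s (vadd x k y) = vadd (sl2 p q r s x) k (sl2 p q r s y)" for x k y
    by (cases x, cases y) (simp add: algebra_simps)
  ultimately show ?thesis unfolding isometry_def by blast
qed

lemma isometry_eichler: "isometry (eichler m n)"
  unfolding isometry_def by (auto simp: algebra_simps)

lemma isometry_comp: "isometry g \<Longrightarrow> isometry h \<Longrightarrow> isometry (g \<circ> h)"
  unfolding isometry_def by (metis comp_apply)

text \<open>Matrices act on row vectors from the right, so composing the maps multiplies them in the
  opposite order.\<close>

lemma sl1_comp:
  "sl1 p q r s \<circ> sl1 p' q' r' s' = sl1 (p' * p + q' * r) (p' * q + q' * s) (r' * p + s' * r) (r' * q + s' * s)"
  by (rule ext) (auto simp: algebra_simps)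

lemma sl2_comp:
  "sl2 p q r s \<circ> sl2 p' q' r' s' = sl2 (p' * p + q' * r) (p' * q + q' * s) (r' * p + s' * r) (r' * q + s' * s)"
  by (rule ext) (auto simp: algebra_simps)

lemma sl1_id: "sl1 1 0 0 1 = id"
  by (rule ext) auto

lemma sl2_id: "sl2 1 0 0 1 = id"
  by (rule ext) auto

lemma sl2_inverse:
  assumes "p * s - q * r = 1"
  shows "sl2 p q r s \<circ> sl2 s (-q) (-r) p = id" "sl2 s (-q) (-r) p \<circ> sl2 p q r s = id"
proof -
  have "s * p - r * q = 1" using assms by (simp add: algebra_simps)
  then show "sl2 p q r s \<circ> sl2 s (-q) (-r) p = id" "sl2 s (-q) (-r) p \<circ> sl2 p q r s = id"
    using assms by (auto simp: sl2_comp sl2_id[symmetric] algebra_simps)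
qed

lemma inv_sl2: "p * s - q * r = 1 \<Longrightarrow> finv (sl2 p q r s) = sl2 s (-q) (-r) p"
  using sl2_inverse by (metis inv_unique_comp)

lemma transv_uminus: "transv (-a, -b, -c, -d) = transv (a, b, c, d)"
  by (rule ext) (auto simp: transv_def algebra_simps)

lemma inv_transv: "finv (transv x) = (\<lambda>v. vadd v (- form v x) x)"
proof -
  have 1: "transv x \<circ> (\<lambda>v. vadd v (- form v x) x) = id"
    by (cases x, rule ext) (auto simp: transv_def algebra_simps)
  have 2: "(\<lambda>v. vadd v (- form v x) x) \<circ> transv x = id"
    by (cases x, rule ext) (auto simp: transv_def algebra_simps)
  show "finv (transv x) = (\<lambda>v. vadd v (- form v x) x)"
    using inv_unique_comp[OF 1 2] .
qed

lemma conj_transv: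
  assumes "isometry g" "bij g"
  shows "g \<circ> transv x \<circ> finv g = transv (g x)"
proof
  fix v
  have v: "g (finv g v) = v" using assms(2) by (simp add: bij_is_surj surj_f_inv_f)
  have "(g \<circ> transv x \<circ> finv g) v = vadd (g (finv g v)) (form (finv g v) x) (g x)"
    using assms(1) by (simp add: transv_def isometry_def del: split_paired_All)
  also have "form (finv g v) x = form (g (finv g v)) (g x)"
    using assms(1) by (simp add: isometry_def del: split_paired_All)
  finally show "(g \<circ> transv x \<circ> finv g) v = transv (g x) v"
    by (simp add: v transv_def)
qed

text \<open>Bezout coefficients of c and d form the column (p, r); the column (q, s) is (-d/m, c/m)
  for m = gcd c d.\<close>

lemma sl2_column_reduction:
  obtains p q r s m :: int where "p * s - q * r = 1" "c * p + d * r = m" "c * q + d * s = 0"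
proof (cases "c = 0 \<and> d = 0")
  case True
  then show ?thesis using that[of 1 1 0 0 0] by simp
next
  case False
  define m where "m = gcd c d"
  have m: "m \<noteq> 0" using False by (simp add: m_def)
  obtain p r where pr: "p * c + r * d = m" using bezout_int[of c d] m_def by blast
  obtain c' d' where cd: "c = m * c'" "d = m * d'"
    using gcd_dvd1[of c d] gcd_dvd2[of c d] unfolding m_def[symmetric] dvd_def by blast
  have "m * (p * c' + r * d') = m * 1" using pr cd by (simp add: algebra_simps)
  then have "p * c' + r * d' = 1" using m by (metis mult_cancel_left)
  then show ?thesis using that[of p c' "- d'" r m] pr cd by (simp add: algebra_simps)
qed

section \<open>Groups of bijections\<close>

locale transformation_group =
  fixes G :: "('a \<Rightarrow> 'a) set"
  assumes id_closed: "id \<in> G"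
    and comp_closed: "g \<in> G \<Longrightarrow> h \<in> G \<Longrightarrow> g \<circ> h \<in> G"
    and bij_mem: "g \<in> G \<Longrightarrow> bij g"
    and inv_closed: "g \<in> G \<Longrightarrow> finv g \<in> G"
begin

lemma cancel_left: "g \<in> G \<Longrightarrow> g \<circ> h \<in> G \<Longrightarrow> h \<in> G"
proof -
  assume g: "g \<in> G" and gh: "g \<circ> h \<in> G"
  have "finv g \<circ> (g \<circ> h) = h"
    using bij_mem[OF g] by (metis bij_is_inj comp_assoc id_comp inj_iff)
  then show ?thesis using comp_closed[OF inv_closed[OF g] gh] by simp
qed

text \<open>f is a homomorphism from (Z, +), so \<open>f 1\<close> generates its range.\<close>

lemma pow_int_closed:
  assumes "\<And>k l :: int. f k \<circ> f l = f (k + l)" "f 0 = id" "f 1 \<in> G"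
  shows "f k \<in> G"
proof (induct k rule: int_induct[where k = 0])
  case base
  then show ?case using id_closed by (simp only: assms(2))
next
  case (step1 i)
  then show ?case using comp_closed[OF step1(2) assms(3)] assms(1) by simp
next
  case (step2 i)
  have "f 1 \<circ> f (i - 1) \<in> G" using step2 assms(1) by simp
  then show ?case by (rule cancel_left[OF assms(3)])
qed

end

lemma transformation_group_transv_image:
  assumes "transformation_group G" "transv x \<in> G" "g \<in> G" "isometry g"
  shows "transv (g x) \<in> G"
proof -
  interpret transformation_group G by fact
  have "g \<circ> transv x \<circ> finv g \<in> G" using assms by (intro comp_closed inv_closed)
  then show ?thesis using conj_transv[OF assms(4) bij_mem[OF assms(3)]] by simp
qed

section \<open>Groups containing four transvections\<close>

text \<open>All that the finite-index argument uses of the hypergeometric group. Elements of G are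
  bijections, but not assumed to be isometries.\<close>

locale generated_by_transvections = transformation_group G
  for G :: "(vec4 \<Rightarrow> vec4) set" +
  assumes tv_e1: "transv (1, 0, 0, 0) \<in> G"
    and tv_f1: "transv (0, 1, 0, 0) \<in> G"
    and tv_e2: "transv (1, 0, 1, 0) \<in> G"
    and tv_f2: "transv (1, 0, 0, 1) \<in> G"
begin

lemma transv_image: "transv x \<in> G \<Longrightarrow> g \<in> G \<Longrightarrow> isometry g \<Longrightarrow> transv (g x) \<in> G"
  using transformation_group_transv_image[OF transformation_group_axioms] .

section \<open>SL(2,Z) on the plane of e1 and f1\<close>

lemma sl1_upper: "sl1 1 k 0 1 \<in> G"
proof (rule pow_int_closed[where f = "\<lambda>k. sl1 1 k 0 1"])
  have "sl1 1 1 0 1 = transv (0, 1, 0, 0)"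
    by (rule ext) (auto simp: transv_def)
  then show "sl1 1 1 0 1 \<in> G" using tv_f1 by simp
qed (auto simp: sl1_comp sl1_id algebra_simps)

lemma sl1_lower: "sl1 1 0 k 1 \<in> G"
proof -
  \<comment> \<open>Because <f1, e1> = -1, the transvection in e1 has parameter -1, so the
    one-parameter family is indexed by -k.\<close>
  have "sl1 1 0 (- (-k)) 1 \<in> G"
  proof (rule pow_int_closed[where f = "\<lambda>k. sl1 1 0 (- k) 1"])
    have "sl1 1 0 (-1) 1 = transv (1, 0, 0, 0)"
      by (rule ext) (auto simp: transv_def)
    then show "sl1 1 0 (-1) 1 \<in> G" using tv_e1 by simp
  qed (auto simp: sl1_comp sl1_id algebra_simps)
  then show ?thesis by simp
qed

lemma sl1_weyl: "sl1 0 1 (-1) 0 \<in> G" "sl1 0 (-1) 1 0 \<in> G"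
proof -
  have "sl1 1 1 0 1 \<circ> (sl1 1 0 (-1) 1 \<circ> sl1 1 1 0 1) \<in> G"
    by (intro comp_closed sl1_upper sl1_lower)
  then show "sl1 0 1 (-1) 0 \<in> G" by (simp add: sl1_comp)
  have "sl1 1 (-1) 0 1 \<circ> (sl1 1 0 1 1 \<circ> sl1 1 (-1) 0 1) \<in> G"
    by (intro comp_closed sl1_upper sl1_lower)
  then show "sl1 0 (-1) 1 0 \<in> G" by (simp add: sl1_comp)
qed

text \<open>Euclidean algorithm on the first row: with t = p div q, a lower unipotent and the Weyl
  element turn (p, q) into (-q, p - t q), which decreases |q|.\<close>

lemma sl1_closed: "p * s - q * r = 1 \<Longrightarrow> sl1 p q r s \<in> G"
proof (induct "nat \<bar>q\<bar>" arbitrary: p q r s rule: less_induct)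
  case less
  show ?case
  proof (cases "q = 0")
    case True
    then have ps: "p * s = 1" using less.prems by simp
    then consider "p = 1" "s = 1" | "p = -1" "s = -1"
      using pos_zmult_eq_1_iff_lemma by (metis minus_mult_minus mult_minus_left zmult_eq_1_iff)
    then show ?thesis
    proof cases
      case 1
      then show ?thesis using True sl1_lower by simp
    next
      case 2
      \<comment> \<open>The square of the Weyl element is minus the identity of the plane.\<close>
      have "sl1 0 1 (-1) 0 \<circ> (sl1 0 1 (-1) 0 \<circ> sl1 1 0 (-r) 1) \<in> G"
        by (intro comp_closed sl1_lower sl1_weyl)
      then show ?thesis using 2 True by (simp add: sl1_comp)
    qed
  next
    case False
    define t where "t = p div q"
    have "\<bar>p - t * q\<bar> < \<bar>q\<bar>"
      using False abs_mod_less[of q p] by (simp add: t_def minus_div_mult_eq_mod)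
    then have "nat \<bar>p - t * q\<bar> < nat \<bar>q\<bar>" by simp
    moreover have "(-q) * (r - t * s) - (p - t * q) * (-s) = 1"
      using less.prems by (simp add: algebra_simps)
    ultimately have "sl1 (-q) (p - t * q) (-s) (r - t * s) \<in> G"
      by (rule less.hyps)
    moreover have "sl1 0 1 (-1) 0 \<circ> (sl1 1 0 (-t) 1 \<circ> sl1 p q r s) = sl1 (-q) (p - t * q) (-s) (r - t * s)"
      by (simp add: sl1_comp algebra_simps)
    ultimately have "sl1 0 1 (-1) 0 \<circ> (sl1 1 0 (-t) 1 \<circ> sl1 p q r s) \<in> G" by simp
    then show ?thesis using cancel_left sl1_weyl sl1_lower by blast
  qed
qed

section \<open>Transvections with centre e1 + y, y in the plane of e2 and f2\<close>

text \<open>The matrix in \<open>sl1\<close> moves (1, 0) to its first row (p, q) and leaves (m, n)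
  alone. Hence the first two coordinates of a centre may be changed freely among primitive
  pairs.\<close>

lemma transv_primitive_iff:
  assumes "p * s - q * r = 1"
  shows "transv (p, q, m, n) \<in> G \<longleftrightarrow> transv (1, 0, m, n) \<in> G"
proof
  have *: "s * p - (-q) * (-r) = 1" using assms by (simp add: algebra_simps)
  assume "transv (p, q, m, n) \<in> G"
  from transv_image[OF this sl1_closed[OF *] isometry_sl1[OF *]]
  show "transv (1, 0, m, n) \<in> G" using assms by (simp add: algebra_simps)
next
  assume "transv (1, 0, m, n) \<in> G"
  from transv_image[OF this sl1_closed[OF assms] isometry_sl1[OF assms]]
  show "transv (p, q, m, n) \<in> G" by simp
qed

lemma transv_neg: "transv (1, 0, m, n) \<in> G \<Longrightarrow> transv (1, 0, -m, -n) \<in> G"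
  using transv_uminus[of "-1" 0 m n] transv_primitive_iff[of "-1" "-1" 0 0 "-m" "-n"]
    transv_uminus[of 1 0 m n] by simp

text \<open>The transvections in y + e1 and y - e1 commute and agree except for the sign of the
  mixed term <v, y> e1 + <v, e1> y, so their quotient has that term twice.\<close>

lemma eichler_double:
  assumes "transv (1, 0, m, n) \<in> G"
  shows "eichler (2 * m) (2 * n) \<in> G"
proof -
  have "transv (-1, 0, m, n) \<in> G"
    using assms transv_primitive_iff[of "-1" "-1" 0 0 m n] by simp
  then have "transv (1, 0, m, n) \<circ> finv (transv (-1, 0, m, n)) \<in> G"
    using assms by (intro comp_closed inv_closed)
  also have "transv (1, 0, m, n) \<circ> finv (transv (-1, 0, m, n)) = eichler (2 * m) (2 * n)"
    by (rule ext) (auto simp: inv_transv transv_def algebra_simps)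
  finally show ?thesis .
qed

text \<open>On the centre f1 + y the Eichler transformation of 2 y' subtracts 2 y', as <f1, e1> =
  -1. The e1-coordinate created on the way is removed by
  \<open>transv_primitive_iff\<close>.\<close>

lemma transv_shift_minus:
  assumes "transv (1, 0, m, n) \<in> G" "transv (1, 0, m', n') \<in> G"
  shows "transv (1, 0, m - 2 * m', n - 2 * n') \<in> G"
proof -
  have "transv (0, 1, m, n) \<in> G"
    using assms(1) transv_primitive_iff[of 0 0 1 "-1"] by simp
  from transv_image[OF this eichler_double[OF assms(2)] isometry_eichler]
  have "transv (16 * (m * n' - n * m'), 1, m - 2 * m', n - 2 * n') \<in> G"
    by (simp add: algebra_simps)
  then show ?thesis
    using transv_primitive_iff[of "16 * (m * n' - n * m')" 0 1 "-1"] by simp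
qed

lemma transv_shift:
  assumes "transv (1, 0, m, n) \<in> G" "transv (1, 0, m', n') \<in> G"
  shows "transv (1, 0, m + 2 * k * m', n + 2 * k * n') \<in> G"
proof (induct k rule: int_induct[where k = 0])
  case base
  then show ?case using assms(1) by simp
next
  case (step1 i)
  then show ?case using transv_shift_minus[OF step1(2) transv_neg[OF assms(2)]]
    by (simp add: algebra_simps)
next
  case (step2 i)
  then show ?case using transv_shift_minus[OF step2(2) assms(2)]
    by (simp add: algebra_simps)
qed

text \<open>Even shifts along e2 and f2 reduce (m, n) modulo 2. The class (1, 1) comes from applying
  the transvection in e1 + f2 to f1 + e2, where the pairing is -1 + 8 = 7.\<close>

lemma transv_closed: "transv (1, 0, m, n) \<in> G"
proof -
  have "transv (0, 1, 1, 0) \<in> G"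
    using tv_e2 transv_primitive_iff[of 0 0 1 "-1"] by simp
  \<comment> \<open>The class of (1, 1) modulo 2 is the only one not reached from 0, e2, f2 by even shifts.\<close>
  from transv_image[OF this tv_f2 isometry_transv]
  have "transv (7, 1, 1, 7) \<in> G" by (simp add: transv_def)
  then have "transv (1, 0, 1, 7) \<in> G"
    using transv_primitive_iff[of 7 0 1 "-1"] by simp
  from transv_shift[OF this tv_f2, of "-3"] have 11: "transv (1, 0, 1, 1) \<in> G" by simp
  have "transv (1, 0, i, j) \<in> G" if "i = 0 \<or> i = 1" "j = 0 \<or> j = 1" for i j
    using that 11 tv_e1 tv_e2 tv_f2 by auto
  then have "transv (1, 0, m mod 2, n mod 2) \<in> G" by (simp add: mod2_eq_if)
  from transv_shift[OF transv_shift[OF this tv_e2, of "m div 2"] tv_f2, of "n div 2"]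
  show ?thesis by simp
qed

section \<open>The congruence subgroup of level 32 in the second SL(2,Z)\<close>

lemma eichler_even: "eichler (2 * m) (2 * n) \<in> G"
  by (rule eichler_double[OF transv_closed])

text \<open>\<open>sl2 1 0 (-16) 1\<close> is the square of the transvection in e2, because <f2, e2>
  = -8. The square of the transvection in e1 + e2 is the product of the squares of those in e1 and
  e2 and of \<open>eichler 2 0\<close>.\<close>

lemma sl2_lower: "sl2 1 0 (16 * k) 1 \<in> G"
proof -
  have "sl2 1 0 (- 16 * (-k)) 1 \<in> G"
  proof (rule pow_int_closed[where f = "\<lambda>k. sl2 1 0 (- 16 * k) 1"])
    have "eichler (2 * 1) (2 * 0) \<circ> sl2 1 0 (- 16 * 1) 1
      = transv (1, 0, 1, 0) \<circ> (transv (1, 0, 1, 0) \<circ> sl1 1 0 2 1)"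
      by (rule ext) (auto simp: transv_def algebra_simps)
    moreover have "transv (1, 0, 1, 0) \<circ> (transv (1, 0, 1, 0) \<circ> sl1 1 0 2 1) \<in> G"
      by (intro comp_closed transv_closed sl1_lower)
    ultimately show "sl2 1 0 (- 16 * 1) 1 \<in> G"
      by (metis cancel_left[OF eichler_even])
  qed (auto simp: sl2_comp sl2_id algebra_simps)
  then show ?thesis by simp
qed


(* The word multiplied to the left of sl2 p q r s moves (0, 0, p, q), the image of e2, back to e2 by
   first creating the e1-coordinate 16, using that p and q are coprime. What is left fixes e2, hence is
   a product of even Eichler transformations and a transvection in e2. *)
lemma sl2_congruence_closed:
  assumes det: "p * s - q * r = 1"
    and "p mod 32 = 1" "q mod 32 = 0" "r mod 32 = 0" "s mod 32 = 1"
  shows "sl2 p q r s \<in> G"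
proof -
  define x y z w where "x = p div 32" and "y = q div 32" and "z = r div 32" and "w = s div 32"
  have p: "p = 1 + 32 * x" and q: "q = 32 * y" and r: "r = 32 * z" and s: "s = 1 + 32 * w"
    using assms(2-5) unfolding x_def y_def z_def w_def by (metis mult_div_mod_eq add.commute add.right_neutral)+
  \<comment> \<open>The determinant condition divided by 32; both \<open>w_eq\<close> and
    \<open>x_eq\<close> are rewritings of it.\<close>
  have "32 * (x + w + 32 * (x * w) - 32 * (y * z)) = p * s - q * r - 1"
    unfolding p q r s by (simp add: algebra_simps)
  then have xw: "x + w = 32 * (y * z) - 32 * (x * w)" using det by simp
  \<comment> \<open>Because q = 32 y, the factor 32 can be moved from q to r; this is the
    determinant of the outermost \<open>sl1\<close> in \<open>?g\<close>.\<close>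
  have *: "s * p - (-y) * (-(32 * r)) = 1"
    using det unfolding q by (simp add: algebra_simps)
  have "r * y - s * x - w = 32 * (y * z) - 32 * (x * w) - (x + w)"
    "r * y - p * w - x = 32 * (y * z) - 32 * (x * w) - (x + w)"
    unfolding p r s by (simp_all add: algebra_simps)
  then have w_eq: "r * y - s * x = w" and x_eq: "r * y - p * w = x" unfolding xw by simp_all
  let ?g = "sl1 s (-y) (- (32 * r)) p \<circ> (eichler (2 * 0) (2 * (-1)) \<circ> (sl1 0 (-1) 1 0 \<circ>
    (sl1 1 0 (-y) 1 \<circ> (eichler (2 * x) (2 * y) \<circ> (sl1 0 1 (-1) 0 \<circ>
    (eichler (2 * r) (2 * s) \<circ> sl2 p q r s))))))"
  \<comment> \<open>The parameter of the inner \<open>sl2\<close> equals r p. The two Eichler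
    transformations contribute -32 x r to the same entry, which leaves r.\<close>
  let ?h = "eichler (2 * r) (2 * 0) \<circ> (sl1 0 1 (-1) 0 \<circ> (eichler (2 * (- x)) (2 * 0) \<circ>
    (sl1 0 (-1) 1 0 \<circ> sl2 1 0 (16 * (2 * (z + 32 * (z * x)))) 1)))"
  have "?g v = ?h v" for v
  proof (cases v)
    case (fields a b c d)
    \<comment> \<open>Facts 1 to 3 evaluate \<open>?g\<close> from the inside outwards. Here e2 goes
      to (16, 0, p, q), the 16 being 16 (p s - q r).\<close>
    have 1: "eichler (2 * r) (2 * s) (sl2 p q r s (a, b, c, d)) =
      (a + 16 * c, b, c * p + d * r - 2 * r * b, c * q + d * s - 2 * s * b)"
    proof -
      have "c = c * (p * s - q * r)" using det by simp
      then show ?thesis by (simp add: algebra_simps)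
    qed
    \<comment> \<open>With 16 moved to the f1-coordinate, the shift by 16 (2 x, 2 y) turns (p, q)
      into (1, 0).\<close>
    have 2: "eichler (2 * x) (2 * y) (sl1 0 1 (-1) 0 (a + 16 * c, b, c * p + d * r - 2 * r * b, c * q + d * s - 2 * s * b)) =
      (16 * c * y + 16 * d * w - b * s, a + 16 * c, c + d * r - 2 * r * b - 2 * x * a, d * s - 2 * s * b - 2 * y * a)"
    proof -
      have "(c * p + d * r - 2 * r * b) * y - (c * q + d * s - 2 * s * b) * x
        = c * (p * y - q * x) + (d - 2 * b) * (r * y - s * x)" by (simp add: algebra_simps)
      also have "\<dots> = c * y + (d - 2 * b) * w" unfolding w_eq by (simp add: p q algebra_simps)
      finally have "16 * ((c * p + d * r - 2 * r * b) * y - (c * q + d * s - 2 * s * b) * x)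
        = 16 * c * y + 16 * d * w - 32 * (b * w)" by (simp add: algebra_simps)
      moreover have "b * s = b + 32 * (b * w)" by (simp add: s algebra_simps)
      ultimately show ?thesis by (simp add: p q algebra_simps)
    qed
    \<comment> \<open>The coordinates 16 y and 16 left from e2 are cleared by a shear, a Weyl
      element and \<open>eichler 0 (-2)\<close>. The outermost \<open>sl1\<close> inverts the matrix
      with rows (p, y) and (32 r, s) that has built up on e1 and f1.\<close>
    have 3: "sl1 s (-y) (- (32 * r)) p (eichler (2 * 0) (2 * (-1)) (sl1 0 (-1) 1 0 (sl1 1 0 (-y) 1
      (16 * c * y + 16 * d * w - b * s, a + 16 * c, c + d * r - 2 * r * b - 2 * x * a, d * s - 2 * s * b - 2 * y * a))))
      = (a - 16 * (r * d), b + 16 * (x * d), c + d * r - 2 * r * b - 2 * x * a, d)"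
    proof -
      have "sl1 s (-y) (- (32 * r)) p (eichler (2 * 0) (2 * (-1)) (sl1 0 (-1) 1 0 (sl1 1 0 (-y) 1
        (16 * c * y + 16 * d * w - b * s, a + 16 * c, c + d * r - 2 * r * b - 2 * x * a, d * s - 2 * s * b - 2 * y * a))))
        = sl1 s (-y) (- (32 * r)) p (a * p + 32 * (r * b) - 16 * (r * d), b * s - 16 * (d * w) + y * a,
            c + d * r - 2 * r * b - 2 * x * a, d * (s - 32 * w))"
        by (simp add: p algebra_simps)
      also have "\<dots> = (a * (s * p - (-y) * (-(32 * r))) - 16 * (r * d) * (s - 32 * w),
        b * (s * p - (-y) * (-(32 * r))) + 16 * d * (r * y - p * w), c + d * r - 2 * r * b - 2 * x * a, d * (s - 32 * w))"
        by (simp add: algebra_simps)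
      finally show ?thesis unfolding * x_eq by (simp add: s)
    qed
    have 4: "?h (a, b, c, d) = (a - 16 * (r * d), b + 16 * (x * d), c + d * r - 2 * r * b - 2 * x * a, d)"
      by (simp add: r algebra_simps)
    show ?thesis using 4 unfolding fields comp_apply 1 2 3 by (rule sym)
  qed
  then have eq: "?g = ?h" by (rule ext)
  have "?h \<in> G"
    by (rule comp_closed[OF eichler_even comp_closed[OF sl1_weyl(1) comp_closed[OF eichler_even
            comp_closed[OF sl1_weyl(2) sl2_lower]]]])
  then have g: "?g \<in> G" by (simp only: eq)
  show ?thesis
    by (rule cancel_left[OF eichler_even cancel_left[OF sl1_weyl(1) cancel_left[OF eichler_even
            cancel_left[OF sl1_lower cancel_left[OF sl1_weyl(2) cancel_left[OF eichler_even
            cancel_left[OF sl1_closed[OF *] g]]]]]]])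
qed

end

section \<open>Isometries fixing e1 and f1\<close>

lemma isometry_inv:
  assumes "isometry g" "bij g"
  shows "isometry (finv g)"
proof -
  have g: "g (finv g v) = v" "finv g (g v) = v" for v
    using assms(2) by (simp_all add: bij_is_surj surj_f_inv_f bij_is_inj)
  have "form (finv g x) (finv g y) = form x y" for x y
    using assms(1) g unfolding isometry_def by metis
  moreover have "finv g (vadd x k y) = vadd (finv g x) k (finv g y)" for x k y
    using assms(1) g unfolding isometry_def by metis
  ultimately show ?thesis unfolding isometry_def by blast
qed

lemma bij_sl2: "p * s - q * r = 1 \<Longrightarrow> bij (sl2 p q r s)"
  using sl2_inverse by (metis o_bij)

text \<open>Such a g preserves the orthogonal complement, which is spanned by e2 and f2; there the
  form is 8 times the determinant.\<close>

lemma isometry_fixing_plane: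
  assumes "isometry g" "g (1, 0, 0, 0) = (1, 0, 0, 0)" "g (0, 1, 0, 0) = (0, 1, 0, 0)"
  obtains p q r s where "p * s - q * r = 1" "g = sl2 p q r s"
proof -
  have form: "form (g x) (g y) = form x y" and lin: "g (vadd x k y) = vadd (g x) k (g y)" for x y k
    using assms(1) unfolding isometry_def by blast+
  obtain i j p q where e2: "g (0, 0, 1, 0) = (i, j, p, q)" by (metis prod.exhaust)
  obtain k l r s where f2: "g (0, 0, 0, 1) = (k, l, r, s)" by (metis prod.exhaust)
  have "i = 0" "j = 0" "k = 0" "l = 0" "p * s - q * r = 1"
    using form[of "(0, 0, 1, 0)" "(1, 0, 0, 0)"] form[of "(0, 0, 1, 0)" "(0, 1, 0, 0)"]
      form[of "(0, 0, 0, 1)" "(1, 0, 0, 0)"] form[of "(0, 0, 0, 1)" "(0, 1, 0, 0)"]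
      form[of "(0, 0, 1, 0)" "(0, 0, 0, 1)"]
    by (auto simp: assms(2,3) e2 f2)
  moreover have "g (a, b, c, d) = sl2 p q r s (a, b, c, d)" for a b c d
  proof -
    \<comment> \<open>The sum starts from the image of e1, hence the coefficient a - 1; this avoids
      computing the image of 0.\<close>
    have "g (a, b, c, d) = vadd (vadd (vadd (vadd (g (1, 0, 0, 0)) (a - 1) (g (1, 0, 0, 0))) b (g (0, 1, 0, 0)))
      c (g (0, 0, 1, 0))) d (g (0, 0, 0, 1))"
      unfolding lin[symmetric] by simp
    then show ?thesis using calculation by (simp add: assms(2,3) e2 f2)
  qed
  ultimately show ?thesis using that[of p s q r] by (metis ext prod.exhaust)
qed

section \<open>The part of G normalised by the second SL(2,Z)\<close>

context generated_by_transvections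
begin

(* Normalised by SL(2,Z) on <e2, f2>, which G itself need not be. *)
definition core :: "(vec4 \<Rightarrow> vec4) set" where
  "core = {h \<in> G. isometry h \<and>
     (\<forall>p q r s. p * s - q * r = 1 \<longrightarrow> sl2 p q r s \<circ> h \<circ> sl2 s (-q) (-r) p \<in> G)}"

lemma coreI:
  assumes "isometry h"
    and "\<And>p q r s. p * s - q * r = 1 \<Longrightarrow> sl2 p q r s \<circ> h \<circ> sl2 s (-q) (-r) p \<in> G"
  shows "h \<in> core"
  using assms assms(2)[of 1 1 0 0] by (simp add: core_def sl2_id)

lemma coreD:
  assumes "h \<in> core"
  shows "h \<in> G" "isometry h" "bij h"
    "p * s - q * r = 1 \<Longrightarrow> sl2 p q r s \<circ> h \<circ> sl2 s (-q) (-r) p \<in> G"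
  using assms bij_mem by (auto simp: core_def)

lemma core_conj:
  assumes "h \<in> core" and det: "p * s - q * r = 1"
  shows "sl2 p q r s \<circ> h \<circ> sl2 s (-q) (-r) p \<in> core"
proof (rule coreI)
  have "s * p - (-q) * (-r) = 1" using det by (simp add: algebra_simps)
  then show "isometry (sl2 p q r s \<circ> h \<circ> sl2 s (-q) (-r) p)"
    using coreD(2)[OF assms(1)] det by (intro isometry_comp isometry_sl2) auto
  fix p' q' r' s' :: int assume det': "p' * s' - q' * r' = 1"
  let ?P = "p * p' + q * r'" and ?Q = "p * q' + q * s'" and ?R = "r * p' + s * r'" and ?S = "r * q' + s * s'"
  have "?P * ?S - ?Q * ?R = (p * s - q * r) * (p' * s' - q' * r')"
    by (simp add: algebra_simps)
  then have "?P * ?S - ?Q * ?R = 1" using det det' by simp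
  from coreD(4)[OF assms(1) this]
  have "(sl2 p' q' r' s' \<circ> sl2 p q r s) \<circ> h \<circ> (sl2 s (-q) (-r) p \<circ> sl2 s' (-q') (-r') p') \<in> G"
    by (simp add: sl2_comp algebra_simps)
  then show "sl2 p' q' r' s' \<circ> (sl2 p q r s \<circ> h \<circ> sl2 s (-q) (-r) p) \<circ> sl2 s' (-q') (-r') p' \<in> G"
    by (simp add: o_assoc)
qed

lemma core_comp:
  assumes "h \<in> core" "k \<in> core"
  shows "h \<circ> k \<in> core"
proof (rule coreI)
  show "isometry (h \<circ> k)" using assms coreD by (blast intro: isometry_comp)
  fix p q r s :: int assume det: "p * s - q * r = 1"
  have "sl2 p q r s \<circ> (h \<circ> k) \<circ> sl2 s (-q) (-r) p =
    (sl2 p q r s \<circ> h \<circ> (sl2 s (-q) (-r) p \<circ> sl2 p q r s) \<circ> k \<circ> sl2 s (-q) (-r) p)"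
    by (simp add: sl2_inverse(2)[OF det] o_assoc)
  also have "\<dots> = (sl2 p q r s \<circ> h \<circ> sl2 s (-q) (-r) p) \<circ> (sl2 p q r s \<circ> k \<circ> sl2 s (-q) (-r) p)"
    by (simp add: o_assoc)
  also have "\<dots> \<in> G" using assms det by (intro comp_closed coreD(4))
  finally show "sl2 p q r s \<circ> (h \<circ> k) \<circ> sl2 s (-q) (-r) p \<in> G" .
qed

lemma core_inv:
  assumes "h \<in> core"
  shows "finv h \<in> core"
proof (rule coreI)
  show "isometry (finv h)" using coreD[OF assms] by (intro isometry_inv)
  fix p q r s :: int assume det: "p * s - q * r = 1"
  have det': "s * p - (-q) * (-r) = 1" using det by (simp add: algebra_simps)
  have "finv (sl2 p q r s \<circ> h \<circ> sl2 s (-q) (-r) p) = sl2 p q r s \<circ> (finv h \<circ> sl2 s (-q) (-r) p)"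
    using det det' coreD(3)[OF assms] by (simp add: o_inv_distrib bij_sl2 bij_comp inv_sl2)
  then show "sl2 p q r s \<circ> finv h \<circ> sl2 s (-q) (-r) p \<in> G"
    using inv_closed[OF coreD(4)[OF assms det]] by (simp add: o_assoc)
qed

lemma sl1_core:
  assumes "p * s - q * r = 1"
  shows "sl1 p q r s \<in> core"
proof (rule coreI[OF isometry_sl1[OF assms]])
  fix p' q' r' s' :: int assume det: "p' * s' - q' * r' = 1"
  have "sl2 p' q' r' s' \<circ> sl1 p q r s = sl1 p q r s \<circ> sl2 p' q' r' s'"
    by (rule ext) auto
  then have "sl2 p' q' r' s' \<circ> sl1 p q r s \<circ> sl2 s' (-q') (-r') p' = sl1 p q r s"
    using sl2_inverse(1)[OF det] by (simp add: comp_assoc)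
  then show "sl2 p' q' r' s' \<circ> sl1 p q r s \<circ> sl2 s' (-q') (-r') p' \<in> G"
    using sl1_closed[OF assms] by simp
qed

text \<open>Conjugation by \<open>sl2\<close> only replaces y in the centre e1 + y, and
  \<open>transv_closed\<close> covers every y.\<close>

lemma transv_core: "transv (1, 0, m, n) \<in> core"
proof (rule coreI[OF isometry_transv])
  fix p q r s :: int assume det: "p * s - q * r = 1"
  have "sl2 p q r s \<circ> transv (1, 0, m, n) \<circ> sl2 s (-q) (-r) p = transv (1, 0, m * p + n * r, m * q + n * s)"
    using conj_transv[OF isometry_sl2[OF det] bij_sl2[OF det], of "(1, 0, m, n)"] inv_sl2[OF det] by simp
  then show "sl2 p q r s \<circ> transv (1, 0, m, n) \<circ> sl2 s (-q) (-r) p \<in> G"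
    using transv_closed by simp
qed

section \<open>Factorisation of every isometry through \<open>core\<close> and the second
  SL(2,Z)\<close>

definition core_sl2 :: "(vec4 \<Rightarrow> vec4) set" where
  "core_sl2 = {h \<circ> sl2 p q r s | h p q r s. h \<in> core \<and> p * s - q * r = 1}"

lemma core_sl2I: "h \<in> core \<Longrightarrow> p * s - q * r = 1 \<Longrightarrow> h \<circ> sl2 p q r s \<in> core_sl2"
  unfolding core_sl2_def by blast

lemma core_sl2E:
  assumes "g \<in> core_sl2"
  obtains h p q r s where "g = h \<circ> sl2 p q r s" "h \<in> core" "p * s - q * r = 1"
  using assms unfolding core_sl2_def by blast

lemma isometry_core_sl2: "g \<in> core_sl2 \<Longrightarrow> isometry g"
  by (erule core_sl2E) (simp add: isometry_comp isometry_sl2 coreD(2))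

lemma core_subset_core_sl2: "h \<in> core \<Longrightarrow> h \<in> core_sl2"
  using core_sl2I[of h 1 1 0 0] by (simp add: sl2_id)

lemma sl2_core_sl2: "p * s - q * r = 1 \<Longrightarrow> sl2 p q r s \<in> core_sl2"
  using core_sl2I[OF sl1_core[of 1 1 0 0], of p s q r] by (simp add: sl1_id)

text \<open>By \<open>core_conj\<close> an element of \<open>core\<close> can be moved past
  \<open>sl2\<close>, so products and inverses regain the factorised form.\<close>

sublocale core_sl2: transformation_group core_sl2
proof
  show "id \<in> core_sl2" using sl2_core_sl2[of 1 1 0 0] by (simp add: sl2_id)
next
  fix g g' assume "g \<in> core_sl2" "g' \<in> core_sl2"
  then obtain h p q r s h' p' q' r' s' where g: "g = h \<circ> sl2 p q r s" "h \<in> core" and det: "p * s - q * r = 1"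
    and g': "g' = h' \<circ> sl2 p' q' r' s'" "h' \<in> core" and det': "p' * s' - q' * r' = 1"
    by (metis core_sl2E)
  have "g \<circ> g' = h \<circ> sl2 p q r s \<circ> h' \<circ> (sl2 s (-q) (-r) p \<circ> sl2 p q r s) \<circ> sl2 p' q' r' s'"
    unfolding g g' by (simp add: sl2_inverse(2)[OF det] o_assoc)
  also have "\<dots> = (h \<circ> (sl2 p q r s \<circ> h' \<circ> sl2 s (-q) (-r) p)) \<circ> (sl2 p q r s \<circ> sl2 p' q' r' s')"
    by (simp add: o_assoc)
  also have "\<dots> \<in> core_sl2"
    unfolding sl2_comp
  proof (rule core_sl2I)
    show "h \<circ> (sl2 p q r s \<circ> h' \<circ> sl2 s (-q) (-r) p) \<in> core"
      using g g' det by (intro core_comp core_conj)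
    have "(p' * p + q' * r) * (r' * q + s' * s) - (p' * q + q' * s) * (r' * p + s' * r)
      = (p * s - q * r) * (p' * s' - q' * r')" by (simp add: algebra_simps)
    then show "(p' * p + q' * r) * (r' * q + s' * s) - (p' * q + q' * s) * (r' * p + s' * r) = 1"
      using det det' by simp
  qed
  finally show "g \<circ> g' \<in> core_sl2" .
next
  fix g assume "g \<in> core_sl2"
  then obtain h p q r s where g: "g = h \<circ> sl2 p q r s" "h \<in> core" and det: "p * s - q * r = 1"
    by (rule core_sl2E)
  have det': "s * p - (-q) * (-r) = 1" using det by (simp add: algebra_simps)
  show "bij g" unfolding g using coreD(3)[OF g(2)] bij_sl2[OF det] by (simp add: bij_comp)
  have "finv g = sl2 s (-q) (-r) p \<circ> finv h"
    unfolding g using coreD(3)[OF g(2)] bij_sl2[OF det] by (simp add: o_inv_distrib inv_sl2[OF det])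
  also have "\<dots> = (sl2 s (-q) (-r) p \<circ> finv h \<circ> sl2 p q r s) \<circ> sl2 s (-q) (-r) p"
    by (simp add: comp_assoc sl2_inverse(1)[OF det])
  also have "\<dots> \<in> core_sl2"
    using core_sl2I[OF core_conj[OF core_inv[OF g(2)] det'] det'] by simp
  finally show "finv g \<in> core_sl2" .
qed

text \<open>For y = m e2 + n f2 the transvection in e1 + y is the commuting product of those in e1
  and y and of \<open>eichler m n\<close>. The matrix is the inverse of the transvection in
  y.\<close>

lemma eichler_core_sl2: "eichler m n \<in> core_sl2"
proof -
  have det: "(1 - 8 * m * n) * (1 + 8 * m * n) - (- 8 * n * n) * (8 * m * m) = 1"
    by (simp add: algebra_simps)
  have "eichler m n = transv (1, 0, m, n) \<circ> (sl1 1 0 1 1 \<circ>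
    sl2 (1 - 8 * m * n) (- 8 * n * n) (8 * m * m) (1 + 8 * m * n))"
    by (rule ext) (auto simp: transv_def algebra_simps)
  also have "\<dots> \<in> core_sl2"
    by (intro core_sl2.comp_closed core_subset_core_sl2 transv_core sl1_core sl2_core_sl2[OF det]) simp
  finally show ?thesis .
qed

text \<open>The hypothesis is what remains of v being the image of e1 under an isometry, with u the
  image of f1. After both planes are reduced it says that a' and 8 c' are coprime.\<close>

lemma core_sl2_transitive:
  assumes "form v u = 1"
  obtains w where "w \<in> core_sl2" "w v = (1, 0, 0, 0)"
proof -
  obtain a b c d where v: "v = (a, b, c, d)" by (metis prod.exhaust)
  obtain p q r s a' where 1: "p * s - q * r = 1" "a * p + b * r = a'" "a * q + b * s = 0"
    by (rule sl2_column_reduction)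
  obtain p' q' r' s' c' where 2: "p' * s' - q' * r' = 1" "c * p' + d * r' = c'" "c * q' + d * s' = 0"
    by (rule sl2_column_reduction)
  let ?w = "sl1 p q r s \<circ> sl2 p' q' r' s'"
  have w: "?w \<in> core_sl2"
    using 1 2 by (intro core_sl2.comp_closed core_subset_core_sl2 sl1_core sl2_core_sl2)
  have wv: "?w v = (a', 0, c', 0)" using 1 2 v by simp
  have "form (?w v) (?w u) = 1"
    using isometry_core_sl2[OF w] assms unfolding isometry_def by metis
  then obtain x y where xy: "a' * x + 8 * c' * y = 1"
    unfolding wv by (cases "?w u") (auto simp: algebra_simps)
  \<comment> \<open>Successive images of (a', 0, c', 0): (0, a', c', 0), then (8 c', a', c', -a'),
    then (0, 1, c', -a') by the Bezout matrix, then f1, then e1.\<close>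
  let ?w' = "sl1 0 (-1) 1 0 \<circ> (eichler c' (- a') \<circ> (sl1 a' y (- (8 * c')) x \<circ>
    (eichler 0 1 \<circ> sl1 0 1 (-1) 0)))"
  have "?w' \<in> core_sl2"
    using xy by (intro core_sl2.comp_closed eichler_core_sl2 core_subset_core_sl2 sl1_core)
      (auto simp: algebra_simps)
  moreover have "?w' (a', 0, c', 0) = (1, 0, 0, 0)"
    using xy by (simp add: algebra_simps)
  ultimately show ?thesis
    using that[of "?w' \<circ> ?w"] w wv core_sl2.comp_closed by (metis comp_apply)
qed

text \<open>Move the image of e1 back to e1. The image of f1 is then (a, 1, c, d), and
  \<open>?u\<close>, which fixes e1, takes it to f1; an \<open>sl2\<close> remains.\<close>

lemma isometry_in_core_sl2:
  assumes "isometry g"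
  shows "g \<in> core_sl2"
proof -
  have "form (g (1, 0, 0, 0)) (g (0, 1, 0, 0)) = 1"
    using assms unfolding isometry_def by simp
  then obtain w where w: "w \<in> core_sl2" "w (g (1, 0, 0, 0)) = (1, 0, 0, 0)"
    by (rule core_sl2_transitive)
  obtain a b c d where f1: "w (g (0, 1, 0, 0)) = (a, b, c, d)" by (metis prod.exhaust)
  have "isometry (w \<circ> g)" using assms w isometry_core_sl2 isometry_comp by blast
  then have "form ((w \<circ> g) (1, 0, 0, 0)) ((w \<circ> g) (0, 1, 0, 0)) = 1"
    unfolding isometry_def by simp
  then have b: "b = 1" using w f1 by simp
  let ?u = "sl1 1 0 (- a) 1 \<circ> eichler c d"
  have u: "?u \<in> core_sl2"
    by (intro core_sl2.comp_closed eichler_core_sl2 core_subset_core_sl2 sl1_core) simp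
  let ?g = "?u \<circ> (w \<circ> g)"
  have "isometry ?g" using \<open>isometry (w \<circ> g)\<close> u isometry_core_sl2 isometry_comp by blast
  moreover have "?g (1, 0, 0, 0) = (1, 0, 0, 0)" using w by simp
  moreover have "?g (0, 1, 0, 0) = (0, 1, 0, 0)" using f1 b by simp
  ultimately obtain p q r s where "p * s - q * r = 1" "?g = sl2 p q r s"
    by (rule isometry_fixing_plane)
  then have "?g \<in> core_sl2" using sl2_core_sl2 by simp
  then show ?thesis using core_sl2.cancel_left[OF u] core_sl2.cancel_left[OF w(1)] by blast
qed

text \<open>The class of g = h \<circ> \<open>sl2 p q r s\<close> records the matrix modulo 32. For
  equal classes the quotient of the matrices is 1 modulo 32, so \<open>sl2_congruence_closed\<close>
  applies, and the factors from \<open>core\<close> lie in G.\<close>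

lemma finite_index_classes:
  obtains cls :: "(vec4 \<Rightarrow> vec4) \<Rightarrow> vec4"
  where "finite (range cls)"
    and "\<And>g g'. isometry g \<Longrightarrow> isometry g' \<Longrightarrow> cls g = cls g' \<Longrightarrow> g \<circ> finv g' \<in> G"
proof -
  have "\<forall>g. \<exists>x. isometry g \<longrightarrow> (\<exists>h p q r s. g = h \<circ> sl2 p q r s \<and> h \<in> core \<and> p * s - q * r = 1 \<and>
      x = (p mod 32, q mod 32, r mod 32, s mod 32))"
  proof
    fix g
    show "\<exists>x. isometry g \<longrightarrow> (\<exists>h p q r s. g = h \<circ> sl2 p q r s \<and> h \<in> core \<and> p * s - q * r = 1 \<and>
      x = (p mod 32, q mod 32, r mod 32, s mod 32))"
      using isometry_in_core_sl2[of g] by (cases "isometry g") (blast elim: core_sl2E, blast)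
  qed
  from choice[OF this] obtain c where c: "\<And>g. isometry g \<Longrightarrow> \<exists>h p q r s. g = h \<circ> sl2 p q r s \<and> h \<in> core \<and> p * s - q * r = 1 \<and>
      c g = (p mod 32, q mod 32, r mod 32, s mod 32)"
    by blast
  \<comment> \<open>The choice function is unconstrained off the isometries; the constant value
    there keeps the range finite.\<close>
  define cls where "cls g = (if isometry g then c g else (0, 0, 0, 0))" for g
  show ?thesis
  proof
    have "range cls \<subseteq> {0..<32} \<times> {0..<32} \<times> {0..<32} \<times> {0..<32}"
    proof (rule image_subsetI)
      fix g
      show "cls g \<in> {0..<32} \<times> {0..<32} \<times> {0..<32} \<times> {0..<32}"
      proof (cases "isometry g")
        case True
        then show ?thesis using c[OF True] by (auto simp: cls_def)
      qed (simp add: cls_def)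
    qed
    then show "finite (range cls)" by (rule finite_subset) simp
  next
    fix g g' assume g: "isometry g" and g': "isometry g'" and eq: "cls g = cls g'"
    obtain h p q r s where h: "g = h \<circ> sl2 p q r s" "h \<in> core" and det: "p * s - q * r = 1"
      and cg: "c g = (p mod 32, q mod 32, r mod 32, s mod 32)" using c[OF g] by blast
    obtain h' p' q' r' s' where h': "g' = h' \<circ> sl2 p' q' r' s'" "h' \<in> core" and det': "p' * s' - q' * r' = 1"
      and cg': "c g' = (p' mod 32, q' mod 32, r' mod 32, s' mod 32)" using c[OF g'] by blast
    have cong: "p mod 32 = p' mod 32" "q mod 32 = q' mod 32" "r mod 32 = r' mod 32" "s mod 32 = s' mod 32"
      using eq g g' cg cg' by (simp_all add: cls_def)
    let ?P = "s' * p + (-q') * r" and ?Q = "s' * q + (-q') * s"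
      and ?R = "(-r') * p + p' * r" and ?S = "(-r') * q + p' * s"
    obtain x y z w where x: "p = p' + 32 * x" and y: "q = q' + 32 * y" and z: "r = r' + 32 * z"
      and w: "s = s' + 32 * w"
      using cong by (metis mod_eqE)
    have "?P * ?S - ?Q * ?R = (p * s - q * r) * (p' * s' - q' * r')"
      by (simp add: algebra_simps)
    then have "?P * ?S - ?Q * ?R = 1" using det det' by simp
    moreover have "?P = 1 + 32 * (s' * x - q' * z)" "?Q = 32 * (s' * y - q' * w)"
      "?R = 32 * (p' * z - r' * x)" "?S = 1 + 32 * (p' * w - r' * y)"
      using det' unfolding x y z w by (simp_all add: algebra_simps)
    then have "?P mod 32 = 1" "?Q mod 32 = 0" "?R mod 32 = 0" "?S mod 32 = 1"
      by presburger+
    ultimately have "sl2 p q r s \<circ> sl2 s' (-q') (-r') p' \<in> G"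
      unfolding sl2_comp by (intro sl2_congruence_closed)
    then have "h \<circ> (sl2 p q r s \<circ> sl2 s' (-q') (-r') p') \<circ> finv h' \<in> G"
      by (intro comp_closed[OF comp_closed] inv_closed coreD(1)[OF h(2)] coreD(1)[OF h'(2)])
    moreover have "finv g' = sl2 s' (-q') (-r') p' \<circ> finv h'"
      unfolding h' using coreD(3)[OF h'(2)] bij_sl2[OF det'] by (simp add: o_inv_distrib inv_sl2[OF det'])
    ultimately show "g \<circ> finv g' \<in> G" unfolding h by (simp add: o_assoc)
  qed
qed

end

section \<open>The hypergeometric group\<close>

fun neg :: "vec4 \<Rightarrow> vec4" where
  "neg (a, b, c, d) = (-a, -b, -c, -d)"

(* mon_a and mon_b are the actions x -> x A and x -> x B of the companion matrices of (1) on row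
   vectors, in the basis e1, f1, e2, f2 chosen in to_std below; mon_a' and mon_b' are their inverses. *)
fun mon_a :: "vec4 \<Rightarrow> vec4" where
  "mon_a (a, b, c, d) =
     (2 * a + 5 * b - 8 * c, -3 * a - 3 * b + 8 * c + 8 * d, -2 * a - b + 5 * c + 8 * d, a + b - 3 * c - 3 * d)"

fun mon_b :: "vec4 \<Rightarrow> vec4" where
  "mon_b (a, b, c, d) =
     (- a + 2 * b + 8 * d, -3 * a - 3 * b + 8 * c + 8 * d, -2 * a - b + 5 * c + 8 * d, a + b - 3 * c - 3 * d)"

fun mon_a' :: "vec4 \<Rightarrow> vec4" where
  "mon_a' (a, b, c, d) =
     (-3 * a - 5 * b + 8 * c + 8 * d, 3 * a + 2 * b - 8 * c - 16 * d, a - 3 * c - 8 * d, - a - b + 3 * c + 5 * d)"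

fun mon_b' :: "vec4 \<Rightarrow> vec4" where
  "mon_b' (a, b, c, d) =
     (-3 * a - 2 * b + 8 * c + 8 * d, 3 * a - b - 8 * c - 16 * d, a - b - 3 * c - 8 * d, - a + 3 * c + 5 * d)"

section \<open>From the companion isometries to the four transvections\<close>

lemma isometry_mon: "isometry mon_a" "isometry mon_b" "isometry mon_a'" "isometry mon_b'"
  unfolding isometry_def by (auto simp: algebra_simps)

lemma isometry_neg: "isometry g \<Longrightarrow> isometry (neg \<circ> g)"
proof -
  have "isometry neg" unfolding isometry_def by auto
  then show "isometry g \<Longrightarrow> isometry (neg \<circ> g)" by (rule isometry_comp)
qed

lemma mon_inverse:
  "mon_a \<circ> mon_a' = id" "mon_a' \<circ> mon_a = id" "mon_b \<circ> mon_b' = id" "mon_b' \<circ> mon_b = id"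
  by (auto simp: fun_eq_iff)

lemma neg_mon_inverse:
  "(neg \<circ> mon_a) \<circ> (neg \<circ> mon_a') = id" "(neg \<circ> mon_a') \<circ> (neg \<circ> mon_a) = id"
  "(neg \<circ> mon_b) \<circ> (neg \<circ> mon_b') = id" "(neg \<circ> mon_b') \<circ> (neg \<circ> mon_b) = id"
  by (auto simp: fun_eq_iff)

text \<open>The second alternative serves the pair (2). The signs disappear because x and -x have
  the same transvection.\<close>

lemma generated_by_transvections_mon:
  assumes "transformation_group G"
    and mon: "mon_a \<in> G \<and> mon_b \<in> G \<or> neg \<circ> mon_a \<in> G \<and> neg \<circ> mon_b \<in> G"
  shows "generated_by_transvections G"
proof -
  interpret transformation_group G by fact
  have mon': "mon_a' \<in> G \<and> mon_b' \<in> G" if "mon_a \<in> G" "mon_b \<in> G"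
    using inv_closed[OF that(1)] inv_closed[OF that(2)]
    by (simp add: inv_unique_comp[OF mon_inverse(1,2)] inv_unique_comp[OF mon_inverse(3,4)])
  have neg_mon': "neg \<circ> mon_a' \<in> G \<and> neg \<circ> mon_b' \<in> G"
    if "neg \<circ> mon_a \<in> G" "neg \<circ> mon_b \<in> G"
    using inv_closed[OF that(1)] inv_closed[OF that(2)]
    by (simp add: inv_unique_comp[OF neg_mon_inverse(1,2)] inv_unique_comp[OF neg_mon_inverse(3,4)])
  have image: "transv (g x) \<in> G" if "transv x \<in> G" "isometry g" "g \<in> G \<or> neg \<circ> g \<in> G" for g x
    using that(3)
  proof
    assume "g \<in> G"
    then show ?thesis using transformation_group_transv_image[OF assms(1) that(1)] that(2) by blast
  next
    assume "neg \<circ> g \<in> G"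
    then have "transv ((neg \<circ> g) x) \<in> G"
      using transformation_group_transv_image[OF assms(1) that(1)] isometry_neg[OF that(2)] by blast
    then show ?thesis by (cases "g x") (simp add: transv_uminus)
  qed
  have fa: "transv (mon_a x) \<in> G" and fb: "transv (mon_b x) \<in> G" 
    and fa_inv: "transv (mon_a' x) \<in> G" and fb_inv: "transv (mon_b' x) \<in> G" if "transv x \<in> G" for x
    using image[OF that] isometry_mon mon mon' neg_mon' by blast+
  \<comment> \<open>Besides the companion isometries, each transvection found so far and its inverse
    can act on the centres.\<close>
  have plus: "transv (vadd x (form x y) y) \<in> G" if "transv x \<in> G" "transv y \<in> G" for x y
    using image[OF that(1) isometry_transv, of y] that(2) by (simp add: transv_def)
  have minus: "transv (vadd x (- form x y) y) \<in> G" if "transv x \<in> G" "transv y \<in> G" for x y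
  proof -
    have "finv (transv y) \<in> G" using inv_closed that(2) by blast
    moreover have "isometry (finv (transv y))"
      unfolding inv_transv isometry_def by (cases y) (auto simp: algebra_simps)
    ultimately show ?thesis using image[OF that(1), of "finv (transv y)"] by (simp add: inv_transv)
  qed
  \<comment> \<open>\<open>mon_a\<close> and \<open>mon_b\<close> differ only in the e1-coordinate,
    namely by the f1-coordinate of the image; in the quotient two signs cancel.\<close>
  have "transv (1, 0, 0, 0) = mon_a \<circ> mon_b'" "transv (1, 0, 0, 0) = (neg \<circ> mon_a) \<circ> (neg \<circ> mon_b')"
    by (auto simp: fun_eq_iff transv_def)
  then have tv_e1: "transv (1, 0, 0, 0) \<in> G" using mon mon' neg_mon' comp_closed by metis
  \<comment> \<open>The following chain of centres was found by a computer search.\<close>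
  have x1: "transv (-3, 3, 1, -1) \<in> G" using fa_inv[OF tv_e1] by simp
  have x2: "transv (3, -4, -1, 1) \<in> G" using fb_inv[OF x1] by simp
  have x3: "transv (-1, 5, 2, -1) \<in> G" using fb_inv[OF x2] by simp
  have x4: "transv (-14, 7, 1, -3) \<in> G" using fa_inv[OF x3] by simp
  have x5: "transv (-9, 12, 7, -5) \<in> G" using fa_inv[OF x4] by simp
  have x6: "transv (-17, 21, 10, -7) \<in> G" using fa_inv[OF x5] by simp
  have x7: "transv (-6, 5, 2, -2) \<in> G" using fa_inv[OF x1] by simp
  have x8: "transv (-7, 8, 4, -3) \<in> G" using fa_inv[OF x7] by simp
  have x9: "transv (18, -19, -10, 8) \<in> G" using plus[OF x6 x8] by simp
  have x10: "transv (-9, 17, 11, -7) \<in> G" using minus[OF x9 x5] by simp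
  have x11: "transv (0, 3, 1, -1) \<in> G" using minus[OF x1 tv_e1] by simp
  have x12: "transv (-2, -9, -6, 3) \<in> G" using fb[OF x11] by simp
  have x13: "transv (8, 9, 7, -2) \<in> G" using fb[OF x12] by simp
  have x14: "transv (-17, 8, 4, -5) \<in> G" using plus[OF x10 x13] by simp
  have x15: "transv (3, 13, 11, -4) \<in> G" using fa_inv[OF x14] by simp
  have x16: "transv (1, -8, -4, 2) \<in> G" using fb_inv[OF x3] by simp
  have x17: "transv (-3, 11, 5, -3) \<in> G" using fb_inv[OF x16] by simp
  have x18: "transv (0, -13, -7, 3) \<in> G" using minus[OF x17 x16] by simp
  have x19: "transv (3, 0, 4, -1) \<in> G" using plus[OF x15 x18] by simp
  have x20: "transv (2, 5, 6, -2) \<in> G" using minus[OF x19 x3] by simp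
  have x21: "transv (1, 10, 8, -3) \<in> G" using minus[OF x20 x3] by simp
  have x22: "transv (7, -4, -1, 1) \<in> G" using plus[OF x2 tv_e1] by simp
  have x23: "transv (2, -3, -2, 1) \<in> G" using fa[OF tv_e1] by simp
  have x24: "transv (-3, 11, 9, -4) \<in> G" using plus[OF x22 x23] by simp
  have x25: "transv (4, -1, -1, 1) \<in> G" using minus[OF x21 x24] by simp
  have x26: "transv (3, -1, -1, 1) \<in> G" using minus[OF x25 tv_e1] by simp
  have x27: "transv (-1, -3, -2, 1) \<in> G" using fb[OF tv_e1] by simp
  have x28: "transv (-1, 4, 3, -1) \<in> G" using fa[OF x27] by simp
  have x29: "transv (-6, 7, 5, -3) \<in> G" using fa[OF x28] by simp
  have x30: "transv (-3, 6, 4, -2) \<in> G" using minus[OF x26 x29] by simp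
  have x31: "transv (5, -5, -3, 2) \<in> G" using fa[OF x23] by simp
  have x32: "transv (2, 1, 1, 0) \<in> G" using plus[OF x30 x31] by simp
  have x33: "transv (0, -1, 0, 0) \<in> G" using fb[OF x32] by simp
  have x34: "transv (1, 1, 1, 0) \<in> G" using plus[OF x32 tv_e1] by simp
  have x35: "transv (1, 0, 1, 0) \<in> G" using minus[OF x34 x33] by simp
  have x36: "transv (1, 0, 0, 1) \<in> G" using fa_inv[OF x20] by simp
  have "transv (0, 1, 0, 0) \<in> G" using x33 transv_uminus[of 0 1 0 0] by simp
  with tv_e1 x35 x36 show ?thesis by unfold_locales
qed

section \<open>Integer matrices as maps of the lattice\<close>

fun row_mult :: "int mat \<Rightarrow> vec4 \<Rightarrow> vec4" where
  "row_mult M (a, b, c, d) =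
     (a * M $$ (0, 0) + b * M $$ (1, 0) + c * M $$ (2, 0) + d * M $$ (3, 0),
      a * M $$ (0, 1) + b * M $$ (1, 1) + c * M $$ (2, 1) + d * M $$ (3, 1),
      a * M $$ (0, 2) + b * M $$ (1, 2) + c * M $$ (2, 2) + d * M $$ (3, 2),
      a * M $$ (0, 3) + b * M $$ (1, 3) + c * M $$ (2, 3) + d * M $$ (3, 3))"

(* e = 1 for the pair (1) and e = -1 for the pair (2). For e = 1 the basis vectors are
   e1 = (0, 0, 0, 1), f1 = (-1, 1, 0, 0), e2 = (1, 0, -1, -2), f2 = (-1, 3, -1, -5); for e = -1 the
   conjugation by diag(1, -1, 1, -1) is built in. *)
fun to_std :: "int \<Rightarrow> vec4 \<Rightarrow> vec4" where
  "to_std e (a, b, c, d) = (- b + c - d, e * (b + 3 * d), - c - d, e * (a - 2 * c - 5 * d))"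

fun of_std :: "int \<Rightarrow> vec4 \<Rightarrow> vec4" where
  "of_std e (a, b, c, d) =
     (3 * a + 3 * e * b + c + e * d, - 3 * a - 2 * e * b - 3 * c, - a - e * b - 2 * c, a + e * b + c)"

text \<open>The action on row vectors in the basis e1, f1, e2, f2; it reverses products.\<close>

definition act :: "int \<Rightarrow> int mat \<Rightarrow> vec4 \<Rightarrow> vec4" where
  "act e M = of_std e \<circ> row_mult M \<circ> to_std e"

text \<open>The form of type (1, 8) in standard coordinates. Invariance under the two companion
  matrices forces these coefficients up to a common factor.\<close>

fun form_std :: "int \<Rightarrow> vec4 \<Rightarrow> vec4 \<Rightarrow> int" where
  "form_std e (a, b, c, d) (a', b', c', d') =
     3 * e * (a * b' - b * a') + 2 * (a * c' - c * a') + 3 * e * (a * d' - d * a')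
     + e * (b * c' - c * b') + 2 * (b * d' - d * b') + 3 * e * (c * d' - d * c')"

definition form_mat :: "int \<Rightarrow> rat mat" where
  "form_mat e = map_mat rat_of_int (mat_of_rows_list 4
     [[0, 3 * e, 2, 3 * e], [- 3 * e, 0, e, 2], [- 2, - e, 0, 3 * e], [- 3 * e, - 2, - 3 * e, 0]])"

definition row4 :: "int mat \<Rightarrow> nat \<Rightarrow> vec4" where
  "row4 M i = (M $$ (i, 0), M $$ (i, 1), M $$ (i, 2), M $$ (i, 3))"

lemma less_4_cases: "(i::nat) < 4 \<Longrightarrow> i = 0 \<or> i = 1 \<or> i = 2 \<or> i = 3"
  by auto

lemma atLeast0_lessThan_4: "{0..<4::nat} = {0, 1, 2, 3}"
  by auto

lemma eq_mat_4_iff: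
  assumes "A \<in> carrier_mat 4 4" "B \<in> carrier_mat 4 4"
  shows "A = B \<longleftrightarrow> (\<forall>i<4. \<forall>j<4. A $$ (i, j) = B $$ (i, j))"
  using eq_matI[of B A] carrier_matD[OF assms(1)] carrier_matD[OF assms(2)] by metis

lemma mult_mat_4:
  fixes A B :: "'a :: comm_semiring_0 mat"
  assumes "A \<in> carrier_mat 4 4" "B \<in> carrier_mat 4 4" "i < 4" "j < 4"
  shows "(A * B) $$ (i, j) = A $$ (i, 0) * B $$ (0, j) + A $$ (i, 1) * B $$ (1, j)
     + A $$ (i, 2) * B $$ (2, j) + A $$ (i, 3) * B $$ (3, j)"
  using assms by (simp add: scalar_prod_def atLeast0_lessThan_4 add.assoc)

lemma to_of_std:
  assumes "e = 1 \<or> e = -1"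
  shows "to_std e (of_std e x) = x" "of_std e (to_std e x) = x"
  using assms by (cases x; auto)+

lemma form_of_std:
  assumes "e = 1 \<or> e = -1"
  shows "form (of_std e x) (of_std e y) = form_std e x y"
  using assms by (cases x; cases y) (auto simp: algebra_simps)

lemma act_mult:
  assumes "e = 1 \<or> e = -1" "M \<in> carrier_mat 4 4" "N \<in> carrier_mat 4 4"
  shows "act e (M * N) = act e N \<circ> act e M"
proof -
  have "row_mult (M * N) x = row_mult N (row_mult M x)" for x
    by (cases x) (simp add: mult_mat_4[OF assms(2,3)] algebra_simps)
  then show ?thesis by (simp add: act_def fun_eq_iff to_of_std[OF assms(1)] del: split_paired_All)
qed

lemma act_one: "e = 1 \<or> e = -1 \<Longrightarrow> act e (1\<^sub>m 4) = id"
proof -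
  assume e: "e = 1 \<or> e = -1"
  have "row_mult (1\<^sub>m 4) x = x" for x by (cases x) simp
  then show ?thesis by (simp add: act_def fun_eq_iff to_of_std[OF e] del: split_paired_All)
qed

lemma act_inject:
  assumes e: "e = 1 \<or> e = -1" and M: "M \<in> carrier_mat 4 4" and N: "N \<in> carrier_mat 4 4"
    and eq: "act e M = act e N"
  shows "M = N"
proof (rule eq_matI)
  have "row_mult M x = row_mult N x" for x
    using fun_cong[OF eq, of "of_std e x"] to_of_std[OF e] unfolding act_def comp_apply by metis
  note this[of "(1, 0, 0, 0)"] this[of "(0, 1, 0, 0)"] this[of "(0, 0, 1, 0)"] this[of "(0, 0, 0, 1)"]
  note rows = this[simplified]
  fix i j assume "i < dim_row N" "j < dim_col N"
  then have "i < 4" "j < 4" using N by auto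
  then show "M $$ (i, j) = N $$ (i, j)" using rows by (auto dest!: less_4_cases)
qed (use M N in auto)

lemma form_mat_carrier: "form_mat e \<in> carrier_mat 4 4"
  by (auto simp: form_mat_def mat_of_rows_list_def)

lemma form_mat_index:
  "i < 4 \<Longrightarrow> j < 4 \<Longrightarrow> form_mat e $$ (i, j) = rat_of_int (form_std e (row4 (1\<^sub>m 4) i) (row4 (1\<^sub>m 4) j))"
  by (auto dest!: less_4_cases simp: form_mat_def mat_of_rows_list_def row4_def)

text \<open>Entry (i, j) of M \<Phi> M^T pairs rows i and j of M. The factor k is carried along
  because an invariant form is only determined up to a scalar.\<close>

lemma form_mat_conj_index:
  assumes M: "M \<in> carrier_mat 4 4" and "i < 4" "j < 4"
  shows "(map_mat rat_of_int M * (k \<cdot>\<^sub>m form_mat e) * transpose_mat (map_mat rat_of_int M)) $$ (i, j)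
    = k * rat_of_int (form_std e (row4 M i) (row4 M j))"
proof -
  have M': "map_mat rat_of_int M \<in> carrier_mat 4 4" "transpose_mat (map_mat rat_of_int M) \<in> carrier_mat 4 4"
    using M by auto
  have P: "k \<cdot>\<^sub>m form_mat e \<in> carrier_mat 4 4" using form_mat_carrier by simp
  have MP: "map_mat rat_of_int M * (k \<cdot>\<^sub>m form_mat e) \<in> carrier_mat 4 4" using M' P by simp
  have [simp]: "dim_row M = 4" "dim_col M = 4" "dim_row (form_mat e) = 4" "dim_col (form_mat e) = 4"
    using M form_mat_carrier[of e] by auto
  show ?thesis
    using assms(2,3)
    by (simp add: mult_mat_4[OF MP M'(2)] mult_mat_4[OF M'(1) P] form_mat_index row4_def algebra_simps
        del: index_mult_mat(1))
qed

lemma preserves_form_mat_iff: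
  assumes M: "M \<in> carrier_mat 4 4" and k: "k \<noteq> 0"
  shows "preserves_form (k \<cdot>\<^sub>m form_mat e) M \<longleftrightarrow>
    (\<forall>i<4. \<forall>j<4. form_std e (row4 M i) (row4 M j) = form_std e (row4 (1\<^sub>m 4) i) (row4 (1\<^sub>m 4) j))"
proof -
  let ?L = "map_mat rat_of_int M * (k \<cdot>\<^sub>m form_mat e) * transpose_mat (map_mat rat_of_int M)"
  have "?L \<in> carrier_mat 4 4" "k \<cdot>\<^sub>m form_mat e \<in> carrier_mat 4 4" using M form_mat_carrier by auto
  then have "?L = k \<cdot>\<^sub>m form_mat e \<longleftrightarrow> (\<forall>i<4. \<forall>j<4. ?L $$ (i, j) = (k \<cdot>\<^sub>m form_mat e) $$ (i, j))"
    by (rule eq_mat_4_iff)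
  moreover have "(k \<cdot>\<^sub>m form_mat e) $$ (i, j) = k * rat_of_int (form_std e (row4 (1\<^sub>m 4) i) (row4 (1\<^sub>m 4) j))"
    if "i < 4" "j < 4" for i j
    using that form_mat_carrier[of e] by (simp add: form_mat_index)
  ultimately show ?thesis
    unfolding preserves_form_def using form_mat_conj_index[OF M] k by simp
qed

lemma isometry_act:
  assumes e: "e = 1 \<or> e = -1" and M: "M \<in> carrier_mat 4 4" and k: "k \<noteq> 0"
    and pres: "preserves_form (k \<cdot>\<^sub>m form_mat e) M"
  shows "isometry (act e M)"
proof -
  have rows: "form_std e (row4 M i) (row4 M j) = form_std e (row4 (1\<^sub>m 4) i) (row4 (1\<^sub>m 4) j)"
    if "i < 4" "j < 4" for i j
    using pres that unfolding preserves_form_mat_iff[OF M k] by blast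
  have std: "form_std e (row_mult M x) (row_mult M y) = form_std e x y" for x y
  proof -
    obtain a b c d where x: "x = (a, b, c, d)" by (metis prod.exhaust)
    obtain a' b' c' d' where y: "y = (a', b', c', d')" by (metis prod.exhaust)
    \<comment> \<open>An alternating form is the sum over pairs of rows, weighted by the 2 x 2
      minors of x and y.\<close>
    have "form_std e (row_mult M x) (row_mult M y) =
      (a * b' - b * a') * form_std e (row4 M 0) (row4 M 1) + (a * c' - c * a') * form_std e (row4 M 0) (row4 M 2)
      + (a * d' - d * a') * form_std e (row4 M 0) (row4 M 3) + (b * c' - c * b') * form_std e (row4 M 1) (row4 M 2)
      + (b * d' - d * b') * form_std e (row4 M 1) (row4 M 3) + (c * d' - d * c') * form_std e (row4 M 2) (row4 M 3)"
      unfolding x y row4_def by (simp add: algebra_simps)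
    also have "\<dots> = form_std e x y"
      using rows[of 0 1] rows[of 0 2] rows[of 0 3] rows[of 1 2] rows[of 1 3] rows[of 2 3]
      by (simp only: x y) (simp add: row4_def)
    finally show ?thesis .
  qed
  have "form (act e M x) (act e M y) = form x y" for x y
    using form_of_std[OF e, of "to_std e x" "to_std e y"]
    by (simp add: act_def form_of_std[OF e] std to_of_std[OF e])
  moreover have "act e M (vadd x k y) = vadd (act e M x) k (act e M y)" for x y k
    by (cases x; cases y) (simp add: act_def algebra_simps)
  ultimately show ?thesis unfolding isometry_def by blast
qed


section \<open>GL(n,Z) and stabilisers of forms\<close>

lemma group_GL_int: "group (GL_int n)"
proof -
  have "monoid (ring_mat TYPE(int) n ())"
    using semiring_mat[where ?'a = int and n = n and b = "()"] by (simp add: semiring_def)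
  then show ?thesis unfolding GL_int_def by (rule monoid.units_group)
qed

lemma GL_int_simps:
  "M \<otimes>\<^bsub>GL_int n\<^esub> N = M * N" "\<one>\<^bsub>GL_int n\<^esub> = 1\<^sub>m n"
  by (simp_all add: GL_int_def units_of_def ring_mat_simps)

lemma carrier_GL_intD: "M \<in> carrier (GL_int n) \<Longrightarrow> M \<in> carrier_mat n n"
  by (simp add: GL_int_def units_of_def Units_def ring_mat_simps)

lemma carrier_GL_intI:
  assumes "M \<in> carrier_mat n n" "N \<in> carrier_mat n n" "M * N = 1\<^sub>m n" "N * M = 1\<^sub>m n"
  shows "M \<in> carrier (GL_int n)"
  using assms by (auto simp: GL_int_def units_of_def Units_def ring_mat_simps)

lemma preserves_form_mult:
  assumes P: "\<Phi> \<in> carrier_mat n n" and g: "g \<in> carrier_mat n n" and h: "h \<in> carrier_mat n n"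
  shows "map_mat rat_of_int (g * h) * \<Phi> * transpose_mat (map_mat rat_of_int (g * h)) =
    map_mat rat_of_int g * (map_mat rat_of_int h * \<Phi> * transpose_mat (map_mat rat_of_int h))
      * transpose_mat (map_mat rat_of_int g)"
proof -
  let ?g = "map_mat rat_of_int g" and ?h = "map_mat rat_of_int h"
  have c: "?g \<in> carrier_mat n n" "?h \<in> carrier_mat n n"
    "transpose_mat ?g \<in> carrier_mat n n" "transpose_mat ?h \<in> carrier_mat n n"
    using g h by auto
  have "map_mat rat_of_int (g * h) = ?g * ?h" using g h by (rule of_int_hom.mat_hom_mult)
  moreover have "transpose_mat (?g * ?h) = transpose_mat ?h * transpose_mat ?g"
    using c by (simp add: transpose_mult)
  moreover have "?g * ?h * \<Phi> * (transpose_mat ?h * transpose_mat ?g) = ?g * (?h * \<Phi> * transpose_mat ?h) * transpose_mat ?g"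
    using c P by (simp add: assoc_mult_mat[of _ n n _ n _ n])
  ultimately show ?thesis by simp
qed

lemma subgroup_preserves_form:
  assumes P: "\<Phi> \<in> carrier_mat n n"
  shows "subgroup {h \<in> carrier (GL_int n). preserves_form \<Phi> h} (GL_int n)"
proof -
  interpret group "GL_int n" by (rule group_GL_int)
  show ?thesis
  proof (rule subgroupI)
    show "{h \<in> carrier (GL_int n). preserves_form \<Phi> h} \<noteq> {}"
    proof -
      have "map_mat rat_of_int (1\<^sub>m n) = 1\<^sub>m n" by (rule of_int_hom.mat_hom_one)
      then have "preserves_form \<Phi> (1\<^sub>m n)" using P by (simp add: preserves_form_def)
      then show ?thesis using one_closed by (auto simp: GL_int_simps)
    qed
  next
    fix h assume h: "h \<in> {h \<in> carrier (GL_int n). preserves_form \<Phi> h}"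
    let ?i = "inv\<^bsub>GL_int n\<^esub> h"
    have i: "?i \<in> carrier (GL_int n)" using h by simp
    have "?i * h = 1\<^sub>m n" using l_inv[of h] h by (simp add: GL_int_simps)
    then have "map_mat rat_of_int (1\<^sub>m n) * \<Phi> * transpose_mat (map_mat rat_of_int (1\<^sub>m n)) =
      map_mat rat_of_int ?i * \<Phi> * transpose_mat (map_mat rat_of_int ?i)"
      using preserves_form_mult[OF P carrier_GL_intD[OF i], of h] h carrier_GL_intD[of h]
      by (simp add: preserves_form_def)
    moreover have "map_mat rat_of_int (1\<^sub>m n) = 1\<^sub>m n" by (rule of_int_hom.mat_hom_one)
    ultimately show "?i \<in> {h \<in> carrier (GL_int n). preserves_form \<Phi> h}"
      using i P by (simp add: preserves_form_def)
  next
    fix g h assume "g \<in> {h \<in> carrier (GL_int n). preserves_form \<Phi> h}"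
      and "h \<in> {h \<in> carrier (GL_int n). preserves_form \<Phi> h}"
    then show "g \<otimes>\<^bsub>GL_int n\<^esub> h \<in> {h \<in> carrier (GL_int n). preserves_form \<Phi> h}"
      using preserves_form_mult[OF P, of g h] carrier_GL_intD m_closed[of g h]
      by (auto simp: preserves_form_def GL_int_simps)
  qed auto
qed

text \<open>On S the map f factors through c; \<open>SOME\<close> picks a representative in each
  fibre that meets S.\<close>

lemma finite_image_if_factors:
  assumes "finite (range c)" "\<And>x y. x \<in> S \<Longrightarrow> y \<in> S \<Longrightarrow> c x = c y \<Longrightarrow> f x = f y"
  shows "finite (f ` S)"
proof (rule finite_subset)
  show "f ` S \<subseteq> (\<lambda>z. f (SOME x. x \<in> S \<and> c x = z)) ` range c"
  proof (rule image_subsetI)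
    fix x assume x: "x \<in> S"
    then have "(SOME y. y \<in> S \<and> c y = c x) \<in> S \<and> c (SOME y. y \<in> S \<and> c y = c x) = c x"
      by (rule someI[where P = "\<lambda>y. y \<in> S \<and> c y = c x", OF conjI]) simp
    then have "f x = f (SOME y. y \<in> S \<and> c y = c x)" using assms(2)[OF x] by metis
    then show "f x \<in> (\<lambda>z. f (SOME x. x \<in> S \<and> c x = z)) ` range c" by blast
  qed
qed (use assms(1) in simp)

text \<open>Carries the index bound from isometries back to matrices. The hypothesis
  \<open>uniq\<close> reduces every invariant form to a multiple of
  \<open>form_mat e\<close>.\<close>

lemma arithmetic_groupI:
  assumes e: "e = 1 \<or> e = -1"
    and A: "A \<in> carrier (GL_int 4)" and B: "B \<in> carrier (GL_int 4)"
    and act: "act e A = mon_a \<and> act e B = mon_b \<or> act e A = neg \<circ> mon_b \<and> act e B = neg \<circ> mon_a"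
    and pres: "preserves_form (form_mat e) A" "preserves_form (form_mat e) B"
    and uniq: "\<And>\<Phi>. \<Phi> \<in> carrier_mat 4 4 \<Longrightarrow> transpose_mat \<Phi> = - \<Phi> \<Longrightarrow> preserves_form \<Phi> A \<Longrightarrow>
      preserves_form \<Phi> B \<Longrightarrow> \<exists>k. \<Phi> = k \<cdot>\<^sub>m form_mat e"
    and nondeg: "nondegenerate_skew_form 4 (form_mat e)"
  shows "arithmetic_group 4 (generate (GL_int 4) {A, inv\<^bsub>GL_int 4\<^esub> B})"
proof -
  interpret GL: group "GL_int 4" by (rule group_GL_int)
  define H where "H = generate (GL_int 4) {A, inv\<^bsub>GL_int 4\<^esub> B}"
  have H: "subgroup H (GL_int 4)"
    unfolding H_def by (rule GL.generate_is_subgroup) (use A B in auto)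
  have "inv\<^bsub>GL_int 4\<^esub> B \<in> H" unfolding H_def by (rule generate.incl) simp
  then have BH: "B \<in> H" using subgroup.m_inv_closed[OF H] B by force
  have AH: "A \<in> H" unfolding H_def by (rule generate.incl) simp
  have pres_iff: "(\<forall>h\<in>H. preserves_form \<Phi> h) \<longleftrightarrow> preserves_form \<Phi> A \<and> preserves_form \<Phi> B"
    if P: "\<Phi> \<in> carrier_mat 4 4" for \<Phi>
  proof
    assume "preserves_form \<Phi> A \<and> preserves_form \<Phi> B"
    then have "{A, inv\<^bsub>GL_int 4\<^esub> B} \<subseteq> {h \<in> carrier (GL_int 4). preserves_form \<Phi> h}"
      using A B subgroup.m_inv_closed[OF subgroup_preserves_form[OF P], of B] by auto
    then have "H \<subseteq> {h \<in> carrier (GL_int 4). preserves_form \<Phi> h}"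
      unfolding H_def by (rule GL.generate_subgroup_incl[OF _ subgroup_preserves_form[OF P]])
    then show "\<forall>h\<in>H. preserves_form \<Phi> h" by blast
  qed (use AH BH in blast)
  have HD: "h \<in> carrier (GL_int 4)" if "h \<in> H" for h
    using subgroup.subset[OF H] that by blast
  have mat: "h \<in> carrier_mat 4 4" if "h \<in> carrier (GL_int 4)" for h
    using that by (rule carrier_GL_intD)
  have act_comp: "act e g \<circ> act e h = act e (h \<otimes>\<^bsub>GL_int 4\<^esub> g)"
    if "g \<in> carrier (GL_int 4)" "h \<in> carrier (GL_int 4)" for g h
    using act_mult[OF e mat[OF that(2)] mat[OF that(1)]] by (simp add: GL_int_simps)
  have act_id: "act e \<one>\<^bsub>GL_int 4\<^esub> = id" using act_one[OF e] by (simp add: GL_int_simps)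
  have bij_act: "bij (act e g)" and inv_act: "finv (act e g) = act e (inv\<^bsub>GL_int 4\<^esub> g)"
    if g: "g \<in> carrier (GL_int 4)" for g
  proof -
    have 1: "act e g \<circ> act e (inv\<^bsub>GL_int 4\<^esub> g) = id" "act e (inv\<^bsub>GL_int 4\<^esub> g) \<circ> act e g = id"
      using g act_id by (simp_all add: act_comp)
    then show "bij (act e g)" "finv (act e g) = act e (inv\<^bsub>GL_int 4\<^esub> g)"
      using o_bij inv_unique_comp by blast+
  qed
  have trafo: "transformation_group (act e ` H)"
  proof
    show "id \<in> act e ` H" using act_id subgroup.one_closed[OF H] by force
    show "g \<circ> h \<in> act e ` H" if "g \<in> act e ` H" "h \<in> act e ` H" for g h
      using that HD act_comp subgroup.m_closed[OF H] by force
    show "bij g" if "g \<in> act e ` H" for g using that HD bij_act by blast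
    show "finv g \<in> act e ` H" if "g \<in> act e ` H" for g
      using that HD inv_act subgroup.m_inv_closed[OF H] by force
  qed
  interpret transvections: generated_by_transvections "act e ` H"
    using trafo by (rule generated_by_transvections_mon) (use act AH BH in force)
  obtain cls :: "(vec4 \<Rightarrow> vec4) \<Rightarrow> vec4" where cls: "finite (range cls)"
    "\<And>g g'. isometry g \<Longrightarrow> isometry g' \<Longrightarrow> cls g = cls g' \<Longrightarrow> g \<circ> finv g' \<in> act e ` H"
    by (rule transvections.finite_index_classes) blast
  have index: "finite_index_subgroup H (Sp_int 4 \<Phi>)"
    if P: "nondegenerate_skew_form 4 \<Phi>" and presH: "\<forall>h\<in>H. preserves_form \<Phi> h" for \<Phi>
  proof -
    have Pc: "\<Phi> \<in> carrier_mat 4 4" and skew: "transpose_mat \<Phi> = - \<Phi>" and det: "det \<Phi> \<noteq> 0"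
      using P by (auto simp: nondegenerate_skew_form_def)
    obtain k where k: "\<Phi> = k \<cdot>\<^sub>m form_mat e"
      using uniq[OF Pc skew] presH AH BH by blast
    have k0: "k \<noteq> 0" using det form_mat_carrier[of e] unfolding k by (auto simp: det_smult)
    define K where "K = {h \<in> carrier (GL_int 4). preserves_form \<Phi> h}"
    have K: "subgroup K (GL_int 4)" unfolding K_def by (rule subgroup_preserves_form[OF Pc])
    have Sp: "Sp_int 4 \<Phi> = (GL_int 4)\<lparr>carrier := K\<rparr>" by (simp add: Sp_int_def K_def)
    have HK: "H \<subseteq> K" using HD presH by (auto simp: K_def)
    have iso: "isometry (act e g)" if "g \<in> K" for g
      using that isometry_act[OF e mat k0] unfolding K_def k by blast
    have "finite ((\<lambda>g. H #>\<^bsub>GL_int 4\<^esub> g) ` K)"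
    proof (rule finite_image_if_factors)
      \<comment> \<open>As \<open>act\<close> reverses products, inverses are classified: then equal
        classes put g' g^-1 in H, which is equality of right cosets.\<close>
      show "finite (range (\<lambda>g. cls (finv (act e g))))"
        using cls(1) by (rule finite_subset[rotated]) blast
      fix g g' assume g: "g \<in> K" and g': "g' \<in> K" and eq: "cls (finv (act e g)) = cls (finv (act e g'))"
      have gc: "g \<in> carrier (GL_int 4)" "g' \<in> carrier (GL_int 4)" using g g' by (auto simp: K_def)
      have "finv (act e g) \<circ> finv (finv (act e g')) \<in> act e ` H"
        using gc by (intro cls(2)[OF _ _ eq] isometry_inv iso[OF g] iso[OF g'] bij_act)
      moreover have "finv (act e g) \<circ> finv (finv (act e g')) = act e (g' \<otimes>\<^bsub>GL_int 4\<^esub> inv\<^bsub>GL_int 4\<^esub> g)"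
        using gc by (simp add: inv_act act_comp)
      ultimately obtain h where h: "h \<in> H" "act e (g' \<otimes>\<^bsub>GL_int 4\<^esub> inv\<^bsub>GL_int 4\<^esub> g) = act e h" by auto
      then have "g' \<otimes>\<^bsub>GL_int 4\<^esub> inv\<^bsub>GL_int 4\<^esub> g = h"
        using gc HD by (intro act_inject[OF e mat mat]) auto
      then have "g' = h \<otimes>\<^bsub>GL_int 4\<^esub> g" using gc HD[OF h(1)] GL.inv_solve_right' by metis
      then have "g' \<in> H #>\<^bsub>GL_int 4\<^esub> g" using h by (auto simp: r_coset_def)
      then show "H #>\<^bsub>GL_int 4\<^esub> g = H #>\<^bsub>GL_int 4\<^esub> g'"
        using GL.repr_independence gc(1) H by blast
    qed
    moreover have "rcosets\<^bsub>Sp_int 4 \<Phi>\<^esub> H = (\<lambda>g. H #>\<^bsub>GL_int 4\<^esub> g) ` K"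
      by (auto simp: Sp RCOSETS_def r_coset_def)
    ultimately show ?thesis
      unfolding finite_index_subgroup_def using GL.subgroup_incl[OF H K HK] Sp by simp
  qed
  show ?thesis
    unfolding arithmetic_group_def H_def[symmetric]
    using index nondeg pres_iff[OF form_mat_carrier] pres by blast
qed

section \<open>Companion matrices of degree 4 and their invariant form\<close>

lemma all_less_4: "(\<forall>i<4. P i) \<longleftrightarrow> P 0 \<and> P 1 \<and> P 2 \<and> P (3 :: nat)"
  using less_4_cases by auto

lemma rows4_carrier: "length rs = 4 \<Longrightarrow> mat_of_rows_list 4 rs \<in> carrier_mat 4 4"
  by (simp add: mat_of_rows_list_def)

lemma rows4_index: "length rs = 4 \<Longrightarrow> i < 4 \<Longrightarrow> j < 4 \<Longrightarrow> mat_of_rows_list 4 rs $$ (i, j) = rs ! i ! j"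
  by (simp add: mat_of_rows_list_def)

text \<open>Belongs to t^4 + r t^3 + q t^2 + p t + 1; all four polynomials have constant coefficient
  1.\<close>

definition companion4 :: "int \<Rightarrow> int \<Rightarrow> int \<Rightarrow> int mat" where
  "companion4 p q r = mat_of_rows_list 4 [[0, 0, 0, -1], [1, 0, 0, -p], [0, 1, 0, -q], [0, 0, 1, -r]]"

lemma companion4_carrier: "companion4 p q r \<in> carrier_mat 4 4"
  by (simp add: companion4_def rows4_carrier)

lemma companion4_index:
  "companion4 p q r $$ (0, 0) = 0" "companion4 p q r $$ (0, 1) = 0" "companion4 p q r $$ (0, 2) = 0"
  "companion4 p q r $$ (0, 3) = -1" "companion4 p q r $$ (1, 0) = 1" "companion4 p q r $$ (1, 1) = 0"
  "companion4 p q r $$ (1, 2) = 0" "companion4 p q r $$ (1, 3) = -p" "companion4 p q r $$ (2, 0) = 0"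
  "companion4 p q r $$ (2, 1) = 1" "companion4 p q r $$ (2, 2) = 0" "companion4 p q r $$ (2, 3) = -q"
  "companion4 p q r $$ (3, 0) = 0" "companion4 p q r $$ (3, 1) = 0" "companion4 p q r $$ (3, 2) = 1"
  "companion4 p q r $$ (3, 3) = -r"
  by (simp_all add: companion4_def rows4_index)

lemma degree_4: "degree [:1, p, q, r, 1 :: int:] = 4"
  by simp

lemma companion_eq_companion4: "companion [:1, p, q, r, 1:] = companion4 p q r"
proof (rule eq_mat_4_iff[THEN iffD2])
  show "\<forall>i<4. \<forall>j<4. companion [:1, p, q, r, 1:] $$ (i, j) = companion4 p q r $$ (i, j)"
    unfolding all_less_4 companion_def degree_4
    by (simp add: companion4_index[simplified] coeff_pCons')
qed (simp_all only: companion4_carrier companion_def degree_4 mat_carrier)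

lemma companion4_GL_int: "companion4 p q r \<in> carrier (GL_int 4)"
proof (rule carrier_GL_intI)
  \<comment> \<open>The inverse matrix, integral because the constant coefficient is 1.\<close>
  let ?N = "mat_of_rows_list 4 [[-p, 1, 0, 0], [-q, 0, 1, 0], [-r, 0, 0, 1], [-1, 0, 0, 0]] :: int mat"
  show N: "?N \<in> carrier_mat 4 4" by (simp add: rows4_carrier)
  show M: "companion4 p q r \<in> carrier_mat 4 4" by (rule companion4_carrier)
  show "companion4 p q r * ?N = 1\<^sub>m 4"
  proof (rule eq_mat_4_iff[THEN iffD2])
    show "\<forall>i<4. \<forall>j<4. (companion4 p q r * ?N) $$ (i, j) = 1\<^sub>m 4 $$ (i, j)"
      by (simp add: all_less_4 mult_mat_4[OF M N] companion4_index[simplified] rows4_index del: index_mult_mat(1))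
  qed (use M N in auto)
  show "?N * companion4 p q r = 1\<^sub>m 4"
  proof (rule eq_mat_4_iff[THEN iffD2])
    show "\<forall>i<4. \<forall>j<4. (?N * companion4 p q r) $$ (i, j) = 1\<^sub>m 4 $$ (i, j)"
      by (simp add: all_less_4 mult_mat_4[OF N M] companion4_index[simplified] rows4_index del: index_mult_mat(1))
  qed (use M N in auto)
qed

text \<open>The matrices belong to f and g of (1), then to f and g of (2). The substitution t -> -t
  exchanges the roles and brings in the sign.\<close>

lemma act_companion4:
  "act 1 (companion4 (-1) 0 (-1)) = mon_a" "act 1 (companion4 2 2 2) = mon_b"
  "act (-1) (companion4 (-2) 2 (-2)) = neg \<circ> mon_b" "act (-1) (companion4 1 0 1) = neg \<circ> mon_a"
  by (auto simp: fun_eq_iff act_def companion4_index[simplified])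

text \<open>The first hypothesis is the last equation of
  \<open>companion4_preserves_form_eqs\<close> for the entries 3 e, 2 and e of
  \<open>form_mat e\<close>; r = p says that the polynomial is palindromic.\<close>

lemma companion4_preserves_form_mat:
  assumes "(1 - q) * (3 * e) + p * 2 = e" "r = p"
  shows "preserves_form (form_mat e) (companion4 p q r)"
proof -
  have "\<forall>i<4. \<forall>j<4. form_std e (row4 (companion4 p q r) i) (row4 (companion4 p q r) j)
    = form_std e (row4 (1\<^sub>m 4) i) (row4 (1\<^sub>m 4) j)"
    using assms by (simp add: all_less_4 row4_def companion4_index[simplified] algebra_simps)
  moreover have "1 \<cdot>\<^sub>m form_mat e = form_mat e" by (rule eq_matI) auto
  ultimately show ?thesis
    using preserves_form_mat_iff[OF companion4_carrier, of 1 e p q r] by simp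
qed

text \<open>Row 0 of the matrix is minus the last unit vector, and row i > 0 is unit vector i - 1
  minus a multiple of the last one. Entries (0, 1), (0, 2), (0, 3) and (1, 2) of the invariance
  equation then give the relations.\<close>

lemma companion4_preserves_form_eqs:
  assumes P: "\<Phi> \<in> carrier_mat 4 4" and skew: "transpose_mat \<Phi> = - \<Phi>"
    and pres: "preserves_form \<Phi> (companion4 p q r)"
  shows "\<Phi> $$ (0, 3) = \<Phi> $$ (0, 1)" "\<Phi> $$ (1, 3) = \<Phi> $$ (0, 2)" "\<Phi> $$ (2, 3) = \<Phi> $$ (0, 1)"
    "\<Phi> $$ (1, 2) = (1 - rat_of_int q) * \<Phi> $$ (0, 1) + rat_of_int p * \<Phi> $$ (0, 2)"
proof -
  let ?M = "map_mat rat_of_int (companion4 p q r)"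
  have M: "?M \<in> carrier_mat 4 4" "transpose_mat ?M \<in> carrier_mat 4 4"
    using companion4_carrier by auto
  have MP: "?M * \<Phi> \<in> carrier_mat 4 4" using M P by simp
  have M': "?M $$ (i, j) = rat_of_int (companion4 p q r $$ (i, j))"
    "transpose_mat ?M $$ (j, i) = rat_of_int (companion4 p q r $$ (i, j))" if "i < 4" "j < 4" for i j
    using that companion4_carrier[of p q r] by auto
  have sk: "\<Phi> $$ (j, i) = - \<Phi> $$ (i, j)" if "i < 4" "j < 4" for i j
    using arg_cong[OF skew, of "\<lambda>A. A $$ (i, j)"] P that by simp
  have eq: "(?M * \<Phi> * transpose_mat ?M) $$ (i, j) = \<Phi> $$ (i, j)" for i j
    using pres unfolding preserves_form_def by simp
  note exp = mult_mat_4[OF MP M(2)] mult_mat_4[OF M(1) P] M' companion4_index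
  have z: "\<Phi> $$ (3, 3) = 0" using sk[of 3 3] by simp
  have "(?M * \<Phi> * transpose_mat ?M) $$ (0, 1) = - \<Phi> $$ (3, 0)"
    "(?M * \<Phi> * transpose_mat ?M) $$ (0, 2) = - \<Phi> $$ (3, 1)"
    "(?M * \<Phi> * transpose_mat ?M) $$ (0, 3) = - \<Phi> $$ (3, 2)"
    "(?M * \<Phi> * transpose_mat ?M) $$ (1, 2) =
      \<Phi> $$ (0, 1) - rat_of_int q * \<Phi> $$ (0, 3) - rat_of_int p * \<Phi> $$ (3, 1)"
    by (simp_all add: exp z algebra_simps del: One_nat_def index_mult_mat(1))
  then have 1: "\<Phi> $$ (0, 1) = - \<Phi> $$ (3, 0)" "\<Phi> $$ (0, 2) = - \<Phi> $$ (3, 1)"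
    "\<Phi> $$ (0, 3) = - \<Phi> $$ (3, 2)"
    "\<Phi> $$ (1, 2) = \<Phi> $$ (0, 1) - rat_of_int q * \<Phi> $$ (0, 3) - rat_of_int p * \<Phi> $$ (3, 1)"
    unfolding eq .
  have 2: "\<Phi> $$ (3, 0) = - \<Phi> $$ (0, 3)" "\<Phi> $$ (3, 1) = - \<Phi> $$ (1, 3)" "\<Phi> $$ (3, 2) = - \<Phi> $$ (2, 3)"
    by (rule sk; simp)+
  show 3: "\<Phi> $$ (0, 3) = \<Phi> $$ (0, 1)" "\<Phi> $$ (1, 3) = \<Phi> $$ (0, 2)" "\<Phi> $$ (2, 3) = \<Phi> $$ (0, 1)"
    using 1(1-3) unfolding 2 by simp_all
  show "\<Phi> $$ (1, 2) = (1 - rat_of_int q) * \<Phi> $$ (0, 1) + rat_of_int p * \<Phi> $$ (0, 2)"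
    using 1(4) unfolding 2 3 by (simp add: algebra_simps)
qed

text \<open>Equating the two expressions for the entry (1, 2) gives 2 e \<Phi>01 = 3 \<Phi>02, so
  one parameter remains.\<close>

lemma companion4_form_unique:
  assumes P: "\<Phi> \<in> carrier_mat 4 4" and skew: "transpose_mat \<Phi> = - \<Phi>"
    and pres: "preserves_form \<Phi> (companion4 p q r)" "preserves_form \<Phi> (companion4 p' q' r')"
    and e: "e = 1 \<or> e = -1" and "p' - p = 3" "q' - q = 2 * e" "3 * e * (1 - q) + 2 * p = e"
  shows "\<exists>k. \<Phi> = k \<cdot>\<^sub>m form_mat e"
proof -
  note eqs = companion4_preserves_form_eqs[OF P skew pres(1)] companion4_preserves_form_eqs(4)[OF P skew pres(2)]
  \<comment> \<open>Normalised by the entry 2 of \<open>form_mat e\<close> at (0, 2).\<close>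
  define k where "k = \<Phi> $$ (0, 2) / 2"
  have sk: "\<Phi> $$ (j, i) = - \<Phi> $$ (i, j)" if "i < 4" "j < 4" for i j
    using arg_cong[OF skew, of "\<lambda>A. A $$ (i, j)"] P that by simp
  have q': "q' = q + 2 * e" and p': "p' = p + 3" using assms(6,7) by simp_all
  have "rat_of_int (3 * e * (1 - q) + 2 * p) = rat_of_int e" using assms(8) by simp
  then have ee: "rat_of_int e * (3 * (1 - rat_of_int q)) + 2 * rat_of_int p = rat_of_int e"
    by (simp add: algebra_simps)
  have "2 * \<Phi> $$ (0, 1) = 3 * rat_of_int e * \<Phi> $$ (0, 2)"
    using eqs(4,5) e unfolding q' p' by (auto simp: algebra_simps)
  then have 01: "\<Phi> $$ (0, 1) = k * (3 * rat_of_int e)" and 02: "\<Phi> $$ (0, 2) = k * 2"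
    by (simp_all add: k_def ac_simps)
  have "\<Phi> $$ (1, 2) = k * (rat_of_int e * (3 * (1 - rat_of_int q)) + 2 * rat_of_int p)"
    using eqs(4) 01 02 by (simp add: algebra_simps)
  then have 12: "\<Phi> $$ (1, 2) = k * rat_of_int e" unfolding ee .
  have "\<forall>i<4. \<forall>j<4. \<Phi> $$ (i, j) = (k \<cdot>\<^sub>m form_mat e) $$ (i, j)"
    using 01 02 12 eqs(1-3) sk[of 0 0] sk[of 1 1] sk[of 2 2] sk[of 3 3] sk[of 0 1] sk[of 0 2] sk[of 0 3]
      sk[of 1 2] sk[of 1 3] sk[of 2 3]
    by (simp add: all_less_4 form_mat_index row4_def carrier_matD[OF form_mat_carrier])
  then have "\<Phi> = k \<cdot>\<^sub>m form_mat e"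
    using eq_mat_4_iff[OF P, of "k \<cdot>\<^sub>m form_mat e"] form_mat_carrier[of e] by simp
  then show ?thesis ..
qed

lemma nondegenerate_form_mat:
  assumes e: "e = 1 \<or> e = -1"
  shows "nondegenerate_skew_form 4 (form_mat e)"
proof -
  \<comment> \<open>The Pfaffian adjoint of \<open>form_mat e\<close>, whose Pfaffian is 9 - 4 + 3 =
    8.\<close>
  let ?N = "map_mat rat_of_int (mat_of_rows_list 4
     [[0, - (3 * e), 2, - e], [3 * e, 0, - (3 * e), 2], [- 2, 3 * e, 0, - (3 * e)], [e, - 2, 3 * e, 0]])"
  have N: "?N \<in> carrier_mat 4 4" by (simp add: rows4_carrier)
  have "form_mat e * ?N = 8 \<cdot>\<^sub>m 1\<^sub>m 4"
  proof (rule eq_mat_4_iff[THEN iffD2])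
    show "\<forall>i<4. \<forall>j<4. (form_mat e * ?N) $$ (i, j) = (8 \<cdot>\<^sub>m 1\<^sub>m 4) $$ (i, j)"
      by (simp add: all_less_4 mult_mat_4[OF form_mat_carrier N] form_mat_index row4_def rows4_index
          carrier_matD[OF rows4_carrier] del: index_mult_mat(1), insert e, auto)
  qed (rule mult_carrier_mat[OF form_mat_carrier N], simp)
  then have "det (form_mat e) * det ?N = 8 ^ 4"
    using det_mult[OF form_mat_carrier N, of e] by (simp add: det_smult)
  then have "det (form_mat e) \<noteq> 0" by auto
  moreover have "transpose_mat (form_mat e) = - form_mat e"
  proof (rule eq_mat_4_iff[THEN iffD2])
    show "\<forall>i<4. \<forall>j<4. transpose_mat (form_mat e) $$ (i, j) = (- form_mat e) $$ (i, j)"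
      by (simp add: all_less_4 form_mat_index row4_def carrier_matD[OF form_mat_carrier])
  qed (use form_mat_carrier in auto)
  ultimately show ?thesis using form_mat_carrier by (simp add: nondegenerate_skew_form_def)
qed

section \<open>The two pairs of polynomials\<close>

lemma hypergeometric_group_4:
  "hypergeometric_group [:1, p, q, r, 1:] [:1, p', q', r', 1:] =
    generate (GL_int 4) {companion4 p q r, inv\<^bsub>GL_int 4\<^esub> (companion4 p' q' r')}"
  unfolding hypergeometric_group_def degree_4 companion_eq_companion4 ..

theorem mainTheorem2:
  shows
    "arithmetic_group 4 (hypergeometric_group
       ([:-1, 1:]^2 * [:1, 1, 1:]) ([:1, 1:]^2 * [:1, 0, 1:])) \<and>
     arithmetic_group 4 (hypergeometric_group
       ([:-1, 1:]^2 * [:1, 0, 1:]) ([:1, 1:]^2 * [:1, -1, 1:]))"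
proof
  have f: "[:-1, 1:]^2 * [:1, 1, 1:] = [:1, -1, 0, -1, 1 :: int:]"
    and g: "[:1, 1:]^2 * [:1, 0, 1:] = [:1, 2, 2, 2, 1 :: int:]"
    by (simp_all add: power2_eq_square)
  have "arithmetic_group 4 (generate (GL_int 4) {companion4 (-1) 0 (-1), inv\<^bsub>GL_int 4\<^esub> (companion4 2 2 2)})"
  proof (rule arithmetic_groupI[where e = 1])
    fix \<Phi> assume "\<Phi> \<in> carrier_mat 4 4" "transpose_mat \<Phi> = - \<Phi>"
      "preserves_form \<Phi> (companion4 (-1) 0 (-1))" "preserves_form \<Phi> (companion4 2 2 2)"
    then show "\<exists>k. \<Phi> = k \<cdot>\<^sub>m form_mat 1" by (rule companion4_form_unique) simp_all
  qed (simp_all add: companion4_GL_int act_companion4 companion4_preserves_form_mat nondegenerate_form_mat)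
  then show "arithmetic_group 4 (hypergeometric_group
       ([:-1, 1:]^2 * [:1, 1, 1:]) ([:1, 1:]^2 * [:1, 0, 1:]))"
    unfolding f g hypergeometric_group_4 .
next
  have f: "[:-1, 1:]^2 * [:1, 0, 1:] = [:1, -2, 2, -2, 1 :: int:]"
    and g: "[:1, 1:]^2 * [:1, -1, 1:] = [:1, 1, 0, 1, 1 :: int:]"
    by (simp_all add: power2_eq_square)
  have "arithmetic_group 4 (generate (GL_int 4) {companion4 (-2) 2 (-2), inv\<^bsub>GL_int 4\<^esub> (companion4 1 0 1)})"
  proof (rule arithmetic_groupI[where e = "-1"])
    fix \<Phi> assume "\<Phi> \<in> carrier_mat 4 4" "transpose_mat \<Phi> = - \<Phi>"
      "preserves_form \<Phi> (companion4 (-2) 2 (-2))" "preserves_form \<Phi> (companion4 1 0 1)"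
    then show "\<exists>k. \<Phi> = k \<cdot>\<^sub>m form_mat (-1)" by (rule companion4_form_unique) simp_all
  qed (simp_all add: companion4_GL_int act_companion4 companion4_preserves_form_mat nondegenerate_form_mat)
  then show "arithmetic_group 4 (hypergeometric_group
       ([:-1, 1:]^2 * [:1, 0, 1:]) ([:1, 1:]^2 * [:1, -1, 1:]))"
    unfolding f g hypergeometric_group_4 .
qed

end
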